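(* Let $q$ be a fixed power of $2$. As $g\to\infty$, (1) $\sum_{u\in\mathcal{H}_{g+1}}L(1,\chi_u)=2\zeta_A(2)\frac{q^{2g+1}}{g}+O\left(\frac{q^{2g}}{g^2}\right)$; (2) $\sum_{P\in\mathcal{P}_{g+1}}\sum_{u\in\mathcal{F}_P}L(1,\chi_u)=\zeta_A(2)\frac{|P|^2}{\log_q|P|}+O(|P|^{\frac32})$; (3) $\sum_{P\in\mathcal{P}_{g+1}}\sum_{u\in\mathcal{F}'_P}L(1,\chi_u)=\zeta_A(2)\frac{|P|^2}{\log_q|P|}+O(|P|^{\frac32})$; where $|P|=q^{g+1}$.
   Context: $q$ is a power of $2$, $A=\mathbb{F}_q[T]$, $k=\mathbb{F}_q(T)$. For nonzero $f\in A$, $|f|=q^{\deg f}$. $\mathcal{P}_n$ is the set of monic irreducible polynomials of degree $n$. Let $\wp(x)=x^2+x$ and fix $\xi\in\mathbb{F}_q\setminus\wp(\mathbb{F}_q)$. Hasse symbol: for $P$ monic irreducible and $u\in k$ integral at $P$, $[u,P)\in\mathbb{F}_2$ is $0$ if $X^2+X\equiv u\pmod P$ is solvable, and $1$ otherwise; for nonzero $N=c\prod_iP_i^{e_i}$ coprime to the denominator of $u$, $[u,N)=\sum_ie_i[u,P_i)$. Set $\{\frac{u}{N}\}=(-1)^{[u,N)}$ if $N$ is coprime to the denominator of $u$, and $0$ otherwise; $\chi_u(f)=\{\frac uf\}$ for monic $f$, and $L(s,\chi_u)=\sum_{f\text{ monic}}\chi_u(f)|f|^{-s}$ (a polynomial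 in $q^{-s}$). For $P$ monic irreducible, $\mathcal{F}_P=\{a/P: a\in A,\ a\neq0,\ \deg a<\deg P\}$, $\mathcal{F}'_P=\{u+\xi:u\in\mathcal{F}_P\}$, $\mathcal{F}_r=\bigcup_{P\in\mathcal{P}_r}\mathcal{F}_P$. For $s\ge1$, $\mathcal{G}_s$ is the set of polynomials $\alpha+\sum_{i=1}^s\alpha_iT^{2i-1}$ with $\alpha\in\{0,\xi\}$, $\alpha_i\in\mathbb{F}_q$, $\alpha_s\ne0$. $\mathcal{H}_{(r,s)}=\{u+F:u\in\mathcal{F}_r,F\in\mathcal{G}_s\}$ and $\mathcal{H}_n=\bigcup_{r=1}^{n-1}\mathcal{H}_{(r,n-r)}$. $\zeta_A(s)=\frac{1}{1-q^{1-s}}$. Implied constants may depend on $q$. *)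

theory Defs
  imports
    "HOL-Analysis.Analysis"
    "HOL-Computational_Algebra.Polynomial_Factorial"
    "HOL-Library.Z2"
    "HOL-Library.Landau_Symbols"
begin

text \<open>
  The finite field of order \<open>q\<close> is a type \<open>'a :: finite_field\<close> with \<open>q = CARD('a)\<close>,
  \<open>A\<close> is the type \<open>'a poly\<close> and \<open>k\<close> is the type \<open>'a poly fract\<close>.
\<close>

definition poly_abs :: "'a::finite_field poly \<Rightarrow> real" where
  "poly_abs f = (if f = 0 then 0 else real CARD('a) ^ degree f)"

definition monic_irreducibles :: "nat \<Rightarrow> 'a::field poly set" where
  "monic_irreducibles n = {P. lead_coeff P = 1 \<and> irreducible P \<and> degree P = n}"

definition wp :: "'b::comm_semiring_1 \<Rightarrow> 'b" where
  "wp x = x ^ 2 + x"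

definition denominator :: "'a::field poly fract \<Rightarrow> 'a poly" where
  "denominator u = (THE b. lead_coeff b = 1 \<and> (\<exists>a. coprime a b \<and> u = Fract a b))"

text \<open>\<open>u\<close> lies in the localization of \<open>A\<close> at \<open>P\<close>.\<close>

definition integral_at :: "'a::field poly \<Rightarrow> 'a poly fract \<Rightarrow> bool" where
  "integral_at P u \<longleftrightarrow> (\<exists>a b. \<not> P dvd b \<and> u = Fract a b)"

definition cong_at :: "'a::field poly \<Rightarrow> 'a poly fract \<Rightarrow> 'a poly fract \<Rightarrow> bool" where
  "cong_at P u v \<longleftrightarrow> (\<exists>w. integral_at P w \<and> u - v = to_fract P * w)"

text \<open>
  The Hasse symbol takes values in the two-element field \<open>bit\<close>. \<open>hasse_prime P u\<close> is meaningful
  only for monic irreducible \<open>P\<close> at which \<open>u\<close> is integral, and \<open>hasse u N\<close> only for nonzero \<open>N\<close>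
  coprime to the denominator of \<open>u\<close>; \<open>hasse_char\<close> uses it only there.
\<close>

definition hasse_prime :: "'a::field poly fract \<Rightarrow> 'a poly \<Rightarrow> bit" where
  "hasse_prime u P = (if \<exists>X. cong_at P (to_fract (wp X)) u then 0 else 1)"

text \<open>
  The library's \<open>multiplicity\<close> is not available for polynomials over an arbitrary field, whose
  type carries no normalization.
\<close>

definition exponent :: "'a::field poly \<Rightarrow> 'a poly \<Rightarrow> nat" where
  "exponent P N = Max {n. P ^ n dvd N}"

definition hasse :: "'a::field poly fract \<Rightarrow> 'a poly \<Rightarrow> bit" where
  "hasse u N = (\<Sum>P | lead_coeff P = 1 \<and> irreducible P \<and> P dvd N.
                  of_nat (exponent P N) * hasse_prime u P)"

definition hasse_char :: "'a::field poly fract \<Rightarrow> 'a poly \<Rightarrow> int" where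
  "hasse_char u N =
     (if coprime N (denominator u) then (if hasse u N = 0 then 1 else -1) else 0)"

text \<open>
  The sum over all monic \<open>f\<close> is grouped by degree. For \<open>\<chi>\<^sub>u\<close> nontrivial all but finitely many of
  the inner sums vanish, so this is the polynomial in \<open>q\<close> to the power \<open>-s\<close>; at \<open>s = 1\<close> the
  ungrouped series does not converge absolutely.
\<close>

definition L_fun :: "complex \<Rightarrow> 'a::finite_field poly fract \<Rightarrow> complex" where
  "L_fun s u = (\<Sum>n. \<Sum>f | lead_coeff f = 1 \<and> degree f = n.
                  of_int (hasse_char u f) * complex_of_real (poly_abs f) powr (-s))"

definition zeta_A :: "nat \<Rightarrow> complex \<Rightarrow> complex" where
  "zeta_A q s = 1 / (1 - of_nat q powr (1 - s))"

definition F_at :: "'a::field poly \<Rightarrow> 'a poly fract set" where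
  "F_at P = {Fract a P | a. a \<noteq> 0 \<and> degree a < degree P}"

definition F'_at :: "'a::field \<Rightarrow> 'a poly \<Rightarrow> 'a poly fract set" where
  "F'_at \<xi> P = {u + to_fract [:\<xi>:] | u. u \<in> F_at P}"

definition F_deg :: "nat \<Rightarrow> 'a::field poly fract set" where
  "F_deg r = (\<Union>P\<in>monic_irreducibles r. F_at P)"

definition G_set :: "'a::field \<Rightarrow> nat \<Rightarrow> 'a poly set" where
  "G_set \<xi> s = {[:\<alpha>:] + (\<Sum>i=1..s. monom (c i) (2 * i - 1)) | \<alpha> c. \<alpha> \<in> {0, \<xi>} \<and> c s \<noteq> 0}"

definition H_pair :: "'a::field \<Rightarrow> nat \<Rightarrow> nat \<Rightarrow> 'a poly fract set" where
  "H_pair \<xi> r s = {u + to_fract F | u F. u \<in> F_deg r \<and> F \<in> G_set \<xi> s}"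

definition H_set :: "'a::field \<Rightarrow> nat \<Rightarrow> 'a poly fract set" where
  "H_set \<xi> n = (\<Union>r\<in>{1..n-1}. H_pair \<xi> r (n - r))"

end

theory Submission
  imports Defs "HOL-Real_Asymp.Real_Asymp"
begin

text \<open>
  By Euler's trace formula and the residue theorem, for \<open>u = a / P + F\<close> and monic \<open>f\<close> prime to \<open>P\<close>
  the symbol \<open>[u, f)\<close> is the absolute trace of \<open>Res\<^sub>P (u df/f) + Res\<^sub>\<infinity> (u df/f)\<close>. It is thus an additive
  character in \<open>(a, F)\<close>, so averaging over \<open>a\<close> and \<open>F\<close> detects those \<open>f\<close> whose derivative is divisible by
  \<open>P\<close>, respectively of small degree. In characteristic two the derivative of \<open>f = A\<^sup>2 + T B\<^sup>2\<close> is \<open>B\<^sup>2\<close>, and below the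
  degree at which the coefficients of the L-function vanish this forces \<open>B = 0\<close>. Hence only the squares
  contribute to the main term, and they sum to \<open>\<zeta>\<^sub>A(2)\<close> up to \<open>O(1/|P|)\<close>. What remains is
  the prime polynomial theorem, which follows from comparing degrees in the factorizations of all
  monic polynomials of degree \<open>n\<close>.
\<close>

subsection \<open>Monic polynomials and completely additive functions\<close>

text \<open>All cancellation comes from sign-reversing involutions: translating \<open>a\<close> or
  \<open>F\<close> kills character averages, and translating \<open>f\<close> by a multiple of
  \<open>P\<close> kills the coefficients of the L-function from degree 2 deg P on (from 2 deg P +
  2s - 1 on if F has degree 2s - 1). So L(1, chi) is a finite sum. If f' = B^2 is nonzero, P | f'
  forces deg f' >= 2 deg P. This is impossible in the relevant range for constant F; for F in G_s
  the average over F first removes every nonsquare f of degree n with deg f' > n - 2s. For a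
  surviving nonsquare f the sum over a is at most 1 in absolute value, coming from the missing a =
  0. In (2) and (3) the character sums cost only O(deg P) per prime, and the exponent 3/2 is that of
  the prime polynomial theorem. In (1), |G_s| zeta_A(2) = 2 q^s, so the zeta value disappears and
  each prime has main term 2 q^(g+1). It returns as q/(q-1) from the sum of q^r/r over r <= g, which
  is q^(g+1)/((q-1)g) + O(q^g/g^2); this expansion also causes the error term of (1).\<close>

definition polys_below :: "nat \<Rightarrow> 'a::zero poly set" where
  "polys_below n = {p. \<forall>i\<ge>n. coeff p i = 0}"

definition monics :: "nat \<Rightarrow> 'a::{zero,one} poly set" where
  "monics n = {f. lead_coeff f = 1 \<and> degree f = n}"

lemma polys_below_iff: "p \<in> polys_below n \<longleftrightarrow> p = 0 \<or> degree p < n"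
  unfolding polys_below_def
  by (auto simp: coeff_eq_0 not_le dest: leading_coeff_0_iff[THEN iffD1])

lemma zero_in_polys_below [simp]: "0 \<in> polys_below n"
  by (simp add: polys_below_iff)

lemma polys_below_add: "p \<in> polys_below n \<Longrightarrow> r \<in> polys_below n \<Longrightarrow> p + r \<in> polys_below n"
  for p r :: "'a::comm_monoid_add poly"
  by (simp add: polys_below_def)

lemma polys_below_diff: "p \<in> polys_below n \<Longrightarrow> r \<in> polys_below n \<Longrightarrow> p - r \<in> polys_below n"
  for p r :: "'a::ab_group_add poly"
  by (simp add: polys_below_def)

lemma polys_below_Suc: "polys_below (Suc n) = (\<lambda>(c, p). pCons c p) ` (UNIV \<times> polys_below n)"
proof (intro set_eqI iffI)
  fix p :: "'a poly"
  assume p: "p \<in> polys_below (Suc n)"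
  obtain c p' where "p = pCons c p'" by (cases p) auto
  moreover from this p have "p' \<in> polys_below n"
    by (fastforce simp: polys_below_def coeff_pCons split: nat.splits)
  ultimately show "p \<in> (\<lambda>(c, p). pCons c p) ` (UNIV \<times> polys_below n)" by auto
qed (auto simp: polys_below_def coeff_pCons split: nat.splits)

lemma polys_below_card:
  "finite (polys_below n :: 'a::{finite,zero} poly set) \<and>
   card (polys_below n :: 'a poly set) = CARD('a) ^ n"
proof (induction n)
  case 0
  have "polys_below 0 = {0 :: 'a poly}" by (auto simp: polys_below_iff)
  then show ?case by simp
next
  case (Suc n)
  have "inj_on (\<lambda>(c, p). pCons c p) (UNIV \<times> polys_below n :: ('a \<times> 'a poly) set)"
    by (auto simp: inj_on_def)
  with Suc show ?case
    by (simp add: polys_below_Suc card_image card_cartesian_product)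
qed

lemma finite_polys_below [simp]: "finite (polys_below n :: 'a::{finite,zero} poly set)"
  and card_polys_below: "card (polys_below n :: 'a poly set) = CARD('a) ^ n"
  using polys_below_card by blast+

lemma monics_eq: "(monics n :: 'a::comm_ring_1 poly set) = (\<lambda>p. monom 1 n + p) ` polys_below n"
proof (intro set_eqI iffI)
  fix f :: "'a poly"
  assume f: "f \<in> monics n"
  have "f - monom 1 n \<in> polys_below n"
    using f by (auto simp: monics_def polys_below_def coeff_eq_0)
  moreover have "f = monom 1 n + (f - monom 1 n)" by simp
  ultimately show "f \<in> (\<lambda>p. monom 1 n + p) ` polys_below n" by blast
next
  fix f :: "'a poly"
  assume "f \<in> (\<lambda>p. monom 1 n + p) ` polys_below n"
  then obtain p where f: "f = monom 1 n + p" "p \<in> polys_below n" by auto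
  then have c: "coeff f n = 1" "\<forall>i>n. coeff f i = 0" by (auto simp: polys_below_def)
  then have "degree f = n" by (metis degree_le le_antisym le_degree zero_neq_one)
  with c show "f \<in> monics n" by (simp add: monics_def)
qed

lemma monics_iff:
  "f \<in> monics n \<longleftrightarrow> coeff f n = 1 \<and> (\<forall>i>n. coeff f i = 0)" for f :: "'a::comm_ring_1 poly"
proof
  assume c: "coeff f n = 1 \<and> (\<forall>i>n. coeff f i = 0)"
  then have "degree f = n" by (metis degree_le le_antisym le_degree zero_neq_one)
  with c show "f \<in> monics n" by (simp add: monics_def)
qed (auto simp: monics_def coeff_eq_0)

lemma monics_add: "f \<in> monics n \<Longrightarrow> p \<in> polys_below n \<Longrightarrow> f + p \<in> monics n"
  for f :: "'a::comm_ring_1 poly"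
  by (simp add: monics_iff polys_below_def)

lemma finite_monics [simp]: "finite (monics n :: 'a::{finite,comm_ring_1} poly set)"
  by (simp add: monics_eq)

lemma card_monics: "card (monics n :: 'a::{finite,comm_ring_1} poly set) = CARD('a) ^ n"
  unfolding monics_eq by (subst card_image) (auto simp: card_polys_below inj_on_def)

lemma monics_nonzero: "f \<in> monics n \<Longrightarrow> f \<noteq> 0" for f :: "'a::comm_ring_1 poly"
  by (auto simp: monics_def)

lemma monics_0: "monics 0 = {1 :: 'a::comm_ring_1 poly}"
  by (auto simp: monics_def elim!: degree_eq_zeroE)

lemma monics_mult:
  "f \<in> monics m \<Longrightarrow> g \<in> monics n \<Longrightarrow> f * g \<in> monics (m + n)" for f :: "'a::idom poly"
  unfolding monics_def by (auto simp: lead_coeff_mult degree_mult_eq) (metis degree_mult_eq leading_coeff_0_iff mult_1 zero_neq_one lead_coeff_mult)+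

lemma monics_mult_cancel:
  fixes f :: "'a::idom poly"
  assumes "f * g \<in> monics n" "f \<in> monics m" shows "m \<le> n" "g \<in> monics (n - m)"
proof -
  have nz: "f \<noteq> 0" "g \<noteq> 0" using assms monics_nonzero by fastforce+
  have "lead_coeff (f * g) = 1" "lead_coeff f = 1" "degree (f * g) = n" "degree f = m"
    using assms by (auto simp: monics_def)
  moreover from this have "lead_coeff g = 1"
    by (metis lead_coeff_mult mult_1)
  ultimately show "m \<le> n" "g \<in> monics (n - m)" using nz
    by (auto simp: monics_def degree_mult_eq)
qed

lemma monic_irreducibles_alt: "monic_irreducibles n = {P \<in> monics n. irreducible P}"
  by (auto simp: monic_irreducibles_def monics_def)

lemma finite_monic_irreducibles [simp]:
  "finite (monic_irreducibles n :: 'a::{finite,field} poly set)"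
  by (simp add: monic_irreducibles_alt)

lemma irreducible_degree_pos: "irreducible P \<Longrightarrow> degree P > 0" for P :: "'a::field poly"
  by (metis irreducible_def is_unit_iff_degree gr0I)

lemma monic_dvd_imp_eq:
  fixes P Q :: "'a::field poly"
  assumes "irreducible P" "irreducible Q" "lead_coeff P = 1" "lead_coeff Q = 1" "P dvd Q"
  shows "P = Q"
proof -
  obtain k where k: "Q = P * k" using assms(5) by (auto elim: dvdE)
  then have "is_unit k" using assms(1,2) by (auto simp: irreducible_def)
  then obtain c where "k = [:c:]" by (auto elim: is_unit_polyE)
  moreover from this k assms(3,4) have "c = 1"
    by (metis lead_coeff_mult mult_1 lead_coeff_pCons(2) degree_pCons_0 coeff_pCons_0)
  ultimately show ?thesis using k by simp
qed

text \<open>\<open>exponent\<close> is a \<open>Max\<close>, hence meaningful only for a finite set;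
  the bound n <= n deg P <= deg f provides finiteness.\<close>

lemma power_dvd_iff_le_exponent:
  fixes P f :: "'a::field poly"
  assumes "irreducible P" "f \<noteq> 0"
  shows "P ^ n dvd f \<longleftrightarrow> n \<le> exponent P f"
proof -
  have "n \<le> degree f" if "P ^ n dvd f" for n
  proof -
    have "P \<noteq> 0" using assms(1) by auto
    then have "n * degree P \<le> degree f"
      using dvd_imp_degree_le[OF that assms(2)] by (simp add: degree_power_eq)
    moreover have "n \<le> n * degree P" using irreducible_degree_pos[OF assms(1)] by simp
    ultimately show ?thesis by linarith
  qed
  then have "{n. P ^ n dvd f} \<subseteq> {..degree f}" by blast
  then have fin: "finite {n. P ^ n dvd f}" by (rule finite_subset) simp
  have "0 \<in> {n. P ^ n dvd f}" by simp
  then have "exponent P f \<in> {n. P ^ n dvd f}"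
    unfolding exponent_def using Max_in[OF fin] by blast
  then have "P ^ n dvd f" if "n \<le> exponent P f"
    using that le_imp_power_dvd dvd_trans by blast
  moreover have "n \<le> exponent P f" if "P ^ n dvd f"
    unfolding exponent_def using that by (intro Max_ge fin) auto
  ultimately show ?thesis by blast
qed

lemma exponent_eqI:
  fixes P f :: "'a::field poly"
  assumes "irreducible P" "f \<noteq> 0" "\<And>n. P ^ n dvd f \<longleftrightarrow> n \<le> m"
  shows "exponent P f = m"
  using assms power_dvd_iff_le_exponent[OF assms(1,2)] by (metis order_antisym order_refl)

lemma prime_power_dvd_mult_cancel:
  fixes P Q :: "'a::field poly"
  assumes "irreducible P" "\<not> P dvd Q" "P ^ k dvd Q * g"
  shows "P ^ k dvd g"
  using assms(3)
proof (induction k arbitrary: g)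
  case (Suc k)
  have "P dvd Q * g" using Suc.prems by (metis dvd_mult_left power_Suc)
  then obtain g' where g: "g = P * g'"
    using prime_elem_dvd_multD[OF field_poly_irreducible_imp_prime[OF assms(1)]] assms(2)
    by (blast elim: dvdE)
  have "P * P ^ k dvd P * (Q * g')" using Suc.prems by (simp only: g mult.left_commute power_Suc)
  then have "P ^ k dvd Q * g'" using assms(1) unfolding dvd_mult_cancel_left by auto
  from Suc.IH[OF this] show ?case unfolding g power_Suc by (rule mult_dvd_mono[OF dvd_refl])
qed simp

lemma exponent_mult_irreducible:
  fixes P Q :: "'a::field poly"
  assumes "irreducible P" "irreducible Q" "lead_coeff P = 1" "lead_coeff Q = 1" "g \<noteq> 0"
  shows "exponent P (Q * g) = exponent P g + (if P = Q then 1 else 0)"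
proof -
  have nz: "Q \<noteq> 0" using assms by auto
  show ?thesis
  proof (rule exponent_eqI)
    fix n
    show "P ^ n dvd Q * g \<longleftrightarrow> n \<le> exponent P g + (if P = Q then 1 else 0)"
    proof (cases "P = Q")
      case True
      then show ?thesis using assms nz
        by (cases n) (auto simp: power_dvd_iff_le_exponent)
    next
      case False
      then have "\<not> P dvd Q" using monic_dvd_imp_eq assms by blast
      then show ?thesis using False assms
        by (auto simp flip: power_dvd_iff_le_exponent dest: prime_power_dvd_mult_cancel)
    qed
  qed (use assms nz in auto)
qed

lemma exponent_0: "irreducible P \<Longrightarrow> f \<noteq> 0 \<Longrightarrow> \<not> P dvd f \<Longrightarrow> exponent P f = 0"
  for P :: "'a::field poly"
  using power_dvd_iff_le_exponent[of P f 1] by simp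

lemma exists_monic_irreducible_dvd:
  fixes f :: "'a::field poly"
  assumes "degree f > 0"
  shows "\<exists>Q. lead_coeff Q = 1 \<and> irreducible Q \<and> Q dvd f"
  using assms
proof (induction "degree f" arbitrary: f rule: less_induct)
  case less
  show ?case
  proof (cases "irreducible f")
    case True
    let ?Q = "smult (inverse (lead_coeff f)) f"
    have "f \<noteq> 0" using True by auto
    then have "is_unit [:inverse (lead_coeff f):]" by (simp add: is_unit_pCons_iff)
    from irreducible_mult_unit_left[OF this, of f] True have "irreducible ?Q" by simp
    moreover from \<open>f \<noteq> 0\<close> have "?Q dvd f" "lead_coeff ?Q = 1" by (auto simp: smult_dvd)
    ultimately show ?thesis by blast
  next
    case False
    have "f \<noteq> 0" using less.prems by auto
    moreover from this have "\<not> is_unit f" using less.prems by (simp add: is_unit_iff_degree)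
    ultimately obtain a b where ab: "f = a * b" "\<not> is_unit a" "\<not> is_unit b"
      using False by (auto simp: irreducible_def)
    with \<open>f \<noteq> 0\<close> have "degree a > 0" "degree a < degree f"
      by (auto simp: is_unit_iff_degree degree_mult_eq)
    from less.hyps[OF this(2,1)] ab show ?thesis by (metis dvd_mult2)
  qed
qed

lemma finite_divisors_poly:
  fixes f :: "'a::{finite,field} poly"
  assumes "f \<noteq> 0" shows "finite {P. R P \<and> P dvd f}"
proof (rule finite_subset)
  show "{P. R P \<and> P dvd f} \<subseteq> polys_below (Suc (degree f))"
    using assms by (auto simp: polys_below_iff less_Suc_eq_le dest: dvd_imp_degree_le)
qed simp

text \<open>Splitting off one monic irreducible factor \<open>Q\<close> adds \<open>G Q\<close> on
  both sides. The codomain is a general semiring because the lemma serves twice: for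
  \<open>degree\<close>, in the prime count, and for a \<open>bit\<close>-valued trace, which is
  thereby identified with \<open>hasse\<close>.\<close>

lemma completely_additive_eq:
  fixes f :: "'a::{finite,field} poly" and G :: "'a poly \<Rightarrow> 'b::comm_semiring_1"
  assumes G_mult: "\<And>f g. lead_coeff f = 1 \<Longrightarrow> lead_coeff g = 1 \<Longrightarrow> G (f * g) = G f + G g"
    and G_1: "G 1 = 0" and f: "lead_coeff f = 1"
  shows "G f = (\<Sum>P | lead_coeff P = 1 \<and> irreducible P \<and> P dvd f. of_nat (exponent P f) * G P)"
  using f
proof (induction "degree f" arbitrary: f rule: less_induct)
  case less
  show ?case
  proof (cases "degree f = 0")
    case True
    with less.prems have "f = 1" by (auto elim!: degree_eq_zeroE)
    moreover from this have "{P. lead_coeff P = 1 \<and> irreducible P \<and> P dvd f} = {}"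
      by (auto simp: irreducible_def)
    ultimately show ?thesis by (simp only: G_1 sum.empty)
  next
    case False
    then obtain Q g where Q: "lead_coeff Q = 1" "irreducible Q" and f: "f = Q * g"
      using exists_monic_irreducible_dvd[of f] by (auto elim!: dvdE)
    have "f \<noteq> 0" using less.prems by auto
    then have nz: "Q \<noteq> 0" "g \<noteq> 0" using f by auto
    have g: "lead_coeff g = 1" using less.prems f Q by (simp add: lead_coeff_mult)
    have "degree g < degree f"
      using f nz irreducible_degree_pos[OF Q(2)] by (simp add: degree_mult_eq)
    note IH = less.hyps[OF this g]
    define D where "D h = {P :: 'a poly. lead_coeff P = 1 \<and> irreducible P \<and> P dvd h}" for h
    have fin: "finite (D f)" unfolding D_def
      using finite_divisors_poly[OF \<open>f \<noteq> 0\<close>, of "\<lambda>P. lead_coeff P = 1 \<and> irreducible P"]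
      by (simp add: conj_assoc)
    have "(\<Sum>P\<in>D f. of_nat (exponent P f) * G P)
        = (\<Sum>P\<in>D f. of_nat (exponent P g) * G P + (if P = Q then G P else 0))"
      by (intro sum.cong refl)
         (auto simp: D_def f exponent_mult_irreducible Q nz algebra_simps)
    also have "\<dots> = (\<Sum>P\<in>D f. of_nat (exponent P g) * G P) + (\<Sum>P\<in>D f. if P = Q then G P else 0)"
      by (rule sum.distrib)
    also have "(\<Sum>P\<in>D f. if P = Q then G P else 0) = G Q"
      using fin Q f by (subst sum.delta) (auto simp: D_def)
    also have "(\<Sum>P\<in>D f. of_nat (exponent P g) * G P) = (\<Sum>P\<in>D g. of_nat (exponent P g) * G P)"
      using nz by (intro sum.mono_neutral_right fin) (auto simp: D_def f exponent_0)
    also have "\<dots> = G g" unfolding D_def using IH by simp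
    finally show ?thesis using G_mult[OF Q(1) g] by (simp add: D_def f add.commute)
  qed
qed

subsection \<open>Counting monic irreducible polynomials\<close>

text \<open>The exponent of \<open>P\<close> is written as the number of k >= 1 with P^k | f. The
  index sets then do not depend on \<open>f\<close>, so that after summing over \<open>f\<close> one
  only has to count multiples of P^k.\<close>

lemma degree_eq_sum_exponent:
  fixes f :: "'a::{finite,field} poly"
  assumes f: "f \<in> monics n"
  shows "n = (\<Sum>d=1..n. \<Sum>P\<in>monic_irreducibles d. \<Sum>k=1..n div d. if P ^ k dvd f then d else 0)"
proof -
  let ?I = "\<Union>d\<in>{1..n}. monic_irreducibles d :: 'a poly set"
  have f': "f \<noteq> 0" "lead_coeff f = 1" "degree f = n"
    using f by (auto simp: monics_def)
  have nz: "p \<noteq> 0" if "lead_coeff p = 1" for p :: "'a poly" using that by auto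
  have "n = degree f" using f' by simp
  also have "\<dots> = (\<Sum>P | lead_coeff P = 1 \<and> irreducible P \<and> P dvd f. exponent P f * degree P)"
    using completely_additive_eq[of "degree :: 'a poly \<Rightarrow> nat", OF _ _ f'(2)]
    by (simp add: degree_mult_eq nz)
  also have "\<dots> = (\<Sum>P\<in>?I. exponent P f * degree P)"
  proof (intro sum.mono_neutral_left ballI)
    show "{P. lead_coeff P = 1 \<and> irreducible P \<and> P dvd f} \<subseteq> ?I"
    proof safe
      fix P assume P: "lead_coeff P = 1" "irreducible P" "P dvd f"
      have "degree P \<le> n" using dvd_imp_degree_le[OF P(3) f'(1)] f'(3) by simp
      moreover have "degree P > 0" using irreducible_degree_pos[OF P(2)] .
      ultimately show "P \<in> ?I" using P by (auto simp: monic_irreducibles_def)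
    qed
  next
    fix P assume "P \<in> ?I - {P. lead_coeff P = 1 \<and> irreducible P \<and> P dvd f}"
    then have "irreducible P" "\<not> P dvd f" by (auto simp: monic_irreducibles_def)
    then show "exponent P f * degree P = 0" by (simp add: exponent_0 f'(1))
  qed simp
  also have "\<dots> = (\<Sum>d=1..n. \<Sum>P\<in>monic_irreducibles d. exponent P f * degree P)"
  proof (rule sum.UNION_disjoint)
    show "\<forall>i\<in>{1..n}. \<forall>j\<in>{1..n}. i \<noteq> j \<longrightarrow> monic_irreducibles i \<inter> (monic_irreducibles j :: 'a poly set) = {}"
      by (auto simp: monic_irreducibles_def)
  qed simp_all
  also have "\<dots> = (\<Sum>d=1..n. \<Sum>P\<in>monic_irreducibles d. \<Sum>k=1..n div d. if P ^ k dvd f then d else 0)"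
  proof (intro sum.cong refl)
    fix d P assume d: "d \<in> {1..n}" and "P \<in> (monic_irreducibles d :: 'a poly set)"
    then have P: "irreducible P" "degree P = d" by (auto simp: monic_irreducibles_def)
    have dvd: "P ^ k dvd f \<longleftrightarrow> k \<le> exponent P f" for k
      using power_dvd_iff_le_exponent[OF P(1) f'(1)] .
    have "P \<noteq> 0" using P by auto
    with dvd have "exponent P f * d \<le> n"
      using dvd_imp_degree_le[OF _ f'(1), of "P ^ exponent P f"] P f' by (simp add: degree_power_eq)
    then have "exponent P f \<le> n div d" using d less_eq_div_iff_mult_less_eq[of d "exponent P f" n] by simp
    then have "{1..n div d} \<inter> {k. k \<le> exponent P f} = {1..exponent P f}" by auto
    then show "exponent P f * degree P = (\<Sum>k=1..n div d. if P ^ k dvd f then d else 0)"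
      by (simp add: dvd sum.If_cases P)
  qed
  finally show ?thesis .
qed

lemma card_monics_dvd:
  fixes P :: "'a::{finite,field} poly"
  assumes "P \<in> monics m" "m \<le> n"
  shows "card {f \<in> monics n. P dvd f} = CARD('a) ^ (n - m)"
proof -
  have "P \<noteq> 0" using assms by (auto simp: monics_def)
  have "{f \<in> monics n. P dvd f} = (*) P ` monics (n - m)"
  proof (intro set_eqI iffI)
    fix f assume "f \<in> {f \<in> monics n. P dvd f}"
    then show "f \<in> (*) P ` monics (n - m)"
      using monics_mult_cancel(2)[OF _ assms(1)] by (auto elim!: dvdE)
  next
    fix f assume "f \<in> (*) P ` monics (n - m)"
    then show "f \<in> {f \<in> monics n. P dvd f}" using monics_mult[OF assms(1)] assms(2) by fastforce
  qed
  moreover have "inj_on ((*) P) (monics (n - m))" using \<open>P \<noteq> 0\<close> by (auto simp: inj_on_def)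
  ultimately show ?thesis by (simp add: card_image card_monics)
qed

lemma monics_power: "P \<in> monics d \<Longrightarrow> P ^ k \<in> monics (k * d)" for P :: "'a::idom poly"
  by (induction k) (auto simp: monics_0 intro: monics_mult)

text \<open>Gauss's formula. Summing degrees over all monic polynomials of degree n gives n q^n as a
  sum over pairs with d k <= n; subtracting q times the identity for n - 1 leaves the pairs with d k
  = n and the value q^n.\<close>

lemma sum_divisors_monic_irreducibles:
  fixes n :: nat
  defines "\<pi> \<equiv> \<lambda>d. card (monic_irreducibles d :: 'a::{finite,field} poly set)"
  assumes n: "n > 0"
  shows "(\<Sum>d | d dvd n. d * \<pi> d) = CARD('a) ^ n"
proof -
  let ?q = "CARD('a)"
  define B :: "nat \<Rightarrow> (nat \<times> nat) set" where "B n = (SIGMA d:{1..n}. {1..n div d})" for n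
  have B: "B n = {(d, k). d \<ge> 1 \<and> k \<ge> 1 \<and> d * k \<le> n}" for n
  proof (intro set_eqI, clarify)
    fix d k :: nat
    have "d \<le> n" if "k \<ge> 1" "d * k \<le> n"
      using that by (metis le_trans mult_le_mono2 mult.right_neutral)
    moreover have "k \<le> n div d \<longleftrightarrow> d * k \<le> n" if "d \<ge> 1"
      using that by (simp add: less_eq_div_iff_mult_less_eq mult.commute)
    ultimately show "(d, k) \<in> B n \<longleftrightarrow> (d, k) \<in> {(d, k). d \<ge> 1 \<and> k \<ge> 1 \<and> d * k \<le> n}"
      unfolding B_def by auto
  qed
  have fin: "finite (B n)" for n unfolding B_def by simp
  have total: "(\<Sum>(d, k)\<in>B n. d * \<pi> d * ?q ^ (n - d * k)) = n * ?q ^ n" for n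
  proof -
    have "n * ?q ^ n = (\<Sum>f\<in>(monics n :: 'a poly set). n)" by (simp add: card_monics)
    also have "\<dots> = (\<Sum>f\<in>(monics n :: 'a poly set). \<Sum>d=1..n. \<Sum>P\<in>monic_irreducibles d. \<Sum>k=1..n div d. if P ^ k dvd f then d else 0)"
      by (intro sum.cong refl degree_eq_sum_exponent)
    also have "\<dots> = (\<Sum>d=1..n. \<Sum>f\<in>(monics n :: 'a poly set). \<Sum>P\<in>monic_irreducibles d. \<Sum>k=1..n div d. if P ^ k dvd f then d else 0)"
      by (rule sum.swap)
    also have "\<dots> = (\<Sum>d=1..n. \<Sum>P\<in>monic_irreducibles d. \<Sum>f\<in>(monics n :: 'a poly set). \<Sum>k=1..n div d. if P ^ k dvd f then d else 0)"
      by (rule sum.cong[OF refl], rule sum.swap)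
    also have "\<dots> = (\<Sum>d=1..n. \<Sum>P\<in>monic_irreducibles d. \<Sum>k=1..n div d. \<Sum>f\<in>(monics n :: 'a poly set). if P ^ k dvd f then d else 0)"
      by (rule sum.cong[OF refl], rule sum.cong[OF refl], rule sum.swap)
    also have "\<dots> = (\<Sum>d=1..n. \<Sum>P\<in>(monic_irreducibles d :: 'a poly set). \<Sum>k=1..n div d. d * ?q ^ (n - d * k))"
    proof (intro sum.cong refl)
      fix d k and P :: "'a poly"
      assume d: "d \<in> {1..n}" and P: "P \<in> monic_irreducibles d" and k: "k \<in> {1..n div d}"
      have "P \<in> monics d" using P by (simp add: monic_irreducibles_alt)
      then have "P ^ k \<in> monics (k * d)" by (rule monics_power)
      moreover have "k * d \<le> n"
        using d k less_eq_div_iff_mult_less_eq[of d k n] by simp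
      ultimately have "card {f \<in> monics n. P ^ k dvd f} = ?q ^ (n - d * k)"
        using card_monics_dvd[of "P ^ k" "k * d" n] by (simp add: mult.commute)
      then show "(\<Sum>f\<in>monics n. if P ^ k dvd f then d else 0) = d * ?q ^ (n - d * k)"
        by (subst sum.inter_filter[symmetric]) simp_all
    qed
    also have "\<dots> = (\<Sum>d=1..n. \<Sum>k=1..n div d. d * \<pi> d * ?q ^ (n - d * k))"
      by (simp add: \<pi>_def sum_distrib_left mult_ac)
    also have "\<dots> = (\<Sum>(d, k)\<in>B n. d * \<pi> d * ?q ^ (n - d * k))"
      unfolding B_def by (subst sum.Sigma) auto
    finally show ?thesis by simp
  qed
  obtain m where m: "n = Suc m" using n by (cases n) auto
  define D where "D = {(d, k). d * k = n}"
  have D: "D = (\<lambda>d. (d, n div d)) ` {d. d dvd n}"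
    using n by (auto simp: D_def image_iff dvd_def)
  \<comment> \<open>Pairs with d k < n are exactly those counted for m = n - 1, each now weighted
    with one more factor q.\<close>
  have "(\<Sum>(d, k)\<in>B n. d * \<pi> d * ?q ^ (n - d * k))
      = (\<Sum>(d, k)\<in>B m. d * \<pi> d * ?q ^ (n - d * k)) + (\<Sum>(d, k)\<in>D. d * \<pi> d * ?q ^ (n - d * k))"
  proof (subst sum.union_disjoint[symmetric])
    show "finite D" using n by (simp add: D)
    have "B n = B m \<union> D" using n by (auto simp: B D_def m le_Suc_eq Suc_le_eq intro!: Nat.gr0I)
    then show "(\<Sum>(d, k)\<in>B n. d * \<pi> d * ?q ^ (n - d * k)) = (\<Sum>(d, k)\<in>B m \<union> D. d * \<pi> d * ?q ^ (n - d * k))"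
      by simp
    show "B m \<inter> D = {}" by (auto simp: B D_def m)
  qed (rule fin)
  also have "(\<Sum>(d, k)\<in>B m. d * \<pi> d * ?q ^ (n - d * k)) = ?q * (m * ?q ^ m)"
    unfolding total[symmetric] sum_distrib_left
    by (intro sum.cong refl) (auto simp: B m Suc_diff_le)
  also have "(\<Sum>(d, k)\<in>D. d * \<pi> d * ?q ^ (n - d * k)) = (\<Sum>d | d dvd n. d * \<pi> d)"
    unfolding D by (subst sum.reindex) (auto simp: inj_on_def intro!: sum.cong)
  finally show ?thesis unfolding total by (simp add: m)
qed

lemma card_monic_irreducibles_le:
  "n * card (monic_irreducibles n :: 'a::{finite,field} poly set) \<le> CARD('a) ^ n"
proof (cases "n = 0")
  case False
  let ?h = "\<lambda>d. d * card (monic_irreducibles d :: 'a poly set)"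
  have "?h n \<le> (\<Sum>d | d dvd n. ?h d)"
    using False by (intro member_le_sum) auto
  with False show ?thesis by (simp add: sum_divisors_monic_irreducibles)
qed simp

lemma card_finite_field_ge_2: "CARD('a::{finite,zero_neq_one}) \<ge> 2"
proof -
  have "card {0, 1 :: 'a} \<le> CARD('a)" by (rule card_mono) auto
  then show ?thesis by simp
qed

lemma sum_powers_le: "q \<ge> 2 \<Longrightarrow> (\<Sum>i\<le>m. q ^ i) \<le> 2 * q ^ m" for q :: nat
proof (induction m)
  case (Suc m)
  have "2 * q ^ m \<le> q ^ Suc m" using Suc.prems by simp
  with Suc.IH[OF Suc.prems] show ?case unfolding sum.atMost_Suc by linarith
qed simp

text \<open>In Gauss's formula the proper divisors of n are at most n div 2, and each contributes at
  most q^d. Their sum is bounded by a geometric series, which is the source of the factor 2 and of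
  the square root.\<close>

lemma prime_polynomial_theorem:
  fixes n :: nat
  defines "q \<equiv> real CARD('a::{finite,field})"
  assumes n: "n > 0"
  shows "\<bar>real (card (monic_irreducibles n :: 'a poly set)) - q ^ n / n\<bar> \<le> 2 * sqrt q ^ n"
proof -
  let ?q = "CARD('a)"
  let ?h = "\<lambda>d. d * card (monic_irreducibles d :: 'a poly set)"
  have q2: "?q \<ge> 2" by (rule card_finite_field_ge_2)
  have "(\<Sum>d | d dvd n. ?h d) = ?h n + (\<Sum>d\<in>{d. d dvd n} - {n}. ?h d)"
    using n by (subst sum.remove[of _ n]) auto
  then have eq: "?q ^ n = ?h n + (\<Sum>d\<in>{d. d dvd n} - {n}. ?h d)"
    using n by (simp add: sum_divisors_monic_irreducibles)
  have "(\<Sum>d\<in>{d. d dvd n} - {n}. ?h d) \<le> (\<Sum>d\<in>{d. d dvd n} - {n}. ?q ^ d)"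
    by (intro sum_mono card_monic_irreducibles_le)
  also have "\<dots> \<le> (\<Sum>d\<le>n div 2. ?q ^ d)"
  proof (intro sum_mono2)
    show "{d. d dvd n} - {n} \<subseteq> {..n div 2}"
    proof
      fix d assume "d \<in> {d. d dvd n} - {n}"
      then have "d dvd n" "d \<noteq> n" by auto
      then obtain k where k: "n = d * k" "k \<noteq> 1" by (auto elim: dvdE)
      with n have "k \<ge> 2" by (cases k) auto
      then have "d * 2 \<le> n" unfolding k(1) by (rule mult_le_mono2)
      then show "d \<in> {..n div 2}" by simp
    qed
  qed auto
  also have "\<dots> \<le> 2 * ?q ^ (n div 2)"
    by (rule sum_powers_le[OF q2])
  finally have le: "(\<Sum>d\<in>{d. d dvd n} - {n}. ?h d) \<le> 2 * ?q ^ (n div 2)" .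
  have "real (?q ^ (n div 2)) = sqrt q ^ (2 * (n div 2))"
    by (simp add: power_mult q_def)
  also have "\<dots> \<le> sqrt q ^ n"
    using q2 by (intro power_increasing) (auto simp: q_def)
  finally have "real (2 * ?q ^ (n div 2)) \<le> 2 * sqrt q ^ n" by simp
  with of_nat_mono[OF le, where 'a = real]
  have le': "real (\<Sum>d\<in>{d. d dvd n} - {n}. ?h d) \<le> 2 * sqrt q ^ n" by (rule order_trans)
  have "real (?h n) - q ^ n = - real (\<Sum>d\<in>{d. d dvd n} - {n}. ?h d)"
    using arg_cong[OF eq, of real] by (simp add: q_def)
  then have "\<bar>n * (real (card (monic_irreducibles n :: 'a poly set)) - q ^ n / n)\<bar> \<le> 2 * sqrt q ^ n"
    using le' n by (simp add: right_diff_distrib flip: of_nat_sum)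
  also have "\<dots> \<le> n * (2 * sqrt q ^ n)" using n by (simp add: q_def)
  finally show ?thesis using n by (simp add: abs_mult)
qed

subsection \<open>Residues and the Artin-Schreier criterion\<close>

lemma mod_in_polys_below:
  "degree P > 0 \<Longrightarrow> x mod P \<in> polys_below (degree P)" for P :: "'a::field poly"
  using degree_mod_less[of P x] by (cases "P = 0") (auto simp: polys_below_iff)

lemma degree_pderiv_less: "degree p > 0 \<Longrightarrow> degree (pderiv p) < degree p"
  for p :: "'a::{comm_semiring_1,semiring_no_zero_divisors} poly"
proof -
  assume "degree p > 0"
  moreover have "degree (pderiv p) \<le> degree p - 1"
    by (rule degree_le) (auto simp: coeff_pderiv coeff_eq_0)
  ultimately show ?thesis by linarith
qed

text \<open>Multiplication by \<open>N\<close> is an injective map of the finite set of reduced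
  residues into itself, so it reaches 1.\<close>

lemma exists_inverse_mod_irreducible:
  fixes P N :: "'a::{finite,field} poly"
  assumes P: "irreducible P" and N: "\<not> P dvd N"
  shows "\<exists>g. P dvd g * N - 1"
proof -
  let ?V = "polys_below (degree P) :: 'a poly set"
  let ?w = "\<lambda>x. (x * N) mod P"
  have P0: "P \<noteq> 0" "degree P > 0" using P irreducible_degree_pos by auto
  have "inj_on ?w ?V"
  proof (rule inj_onI)
    fix x y assume xy: "x \<in> ?V" "y \<in> ?V" and "?w x = ?w y"
    then have "P dvd (x - y) * N" by (simp add: mod_eq_dvd_iff left_diff_distrib)
    then have "P dvd x - y"
      using N prime_elem_dvd_multD[OF field_poly_irreducible_imp_prime[OF P]] by blast
    moreover have "x - y \<in> ?V" using xy by (rule polys_below_diff)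
    ultimately show "x = y" by (auto simp: polys_below_iff dest: dvd_imp_degree_le)
  qed
  moreover have "?w ` ?V \<subseteq> ?V"
    using mod_in_polys_below[OF P0(2)] by blast
  ultimately have "?w ` ?V = ?V" by (intro endo_inj_surj) auto
  moreover have "1 \<in> ?V" using P0 by (simp add: polys_below_iff)
  ultimately have "1 \<in> ?w ` ?V" by simp
  then obtain g where "1 = (g * N) mod P" by (rule imageE)
  from arg_cong[OF this, of "\<lambda>x. x mod P"] have "(g * N) mod P = 1 mod P" by simp
  then have "P dvd g * N - 1" by (simp only: mod_eq_dvd_iff)
  then show ?thesis ..
qed

text \<open>For monic \<open>f\<close> this is the coefficient of \<open>1/T\<close> in the expansion of \<open>N / f\<close> at infinity, the
  sum of the residues of \<open>(N / f) dT\<close> at the zeros of \<open>f\<close>.\<close>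

definition res :: "'a::field poly \<Rightarrow> 'a poly \<Rightarrow> 'a" where
  "res f N = coeff (N mod f) (degree f - 1)"

lemma res_add: "res f (M + N) = res f M + res f N"
  by (simp add: res_def poly_mod_add_left)

lemma res_smult: "res f (smult c N) = c * res f N"
  by (simp add: res_def mod_smult_left)

lemma res_eq_0_of_dvd: "f dvd N \<Longrightarrow> res f N = 0"
  by (simp add: res_def dvd_eq_mod_eq_0)

lemma res_cong: "f dvd M - N \<Longrightarrow> res f M = res f N"
  by (simp add: res_def flip: mod_eq_dvd_iff)

lemma res_degree_less: "degree N < degree f \<Longrightarrow> res f N = coeff N (degree f - 1)"
  by (simp add: res_def mod_poly_less)

lemma coeff_mult_top:
  fixes r g :: "'a::comm_semiring_0 poly"
  assumes "degree r \<le> m" "degree g \<le> n"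
  shows "coeff (r * g) (m + n) = coeff r m * coeff g n"
proof -
  have "coeff (r * g) (m + n) = (\<Sum>i\<le>m + n. coeff r i * coeff g (m + n - i))"
    by (rule coeff_mult)
  also have "\<dots> = (\<Sum>i\<le>m + n. if i = m then coeff r m * coeff g n else 0)"
  proof (intro sum.cong refl)
    fix i show "coeff r i * coeff g (m + n - i) = (if i = m then coeff r m * coeff g n else 0)"
      using assms by (cases i m rule: linorder_cases) (auto simp: coeff_eq_0)
  qed
  finally show ?thesis by simp
qed

text \<open>N/f and Ng/(fg) are the same fraction; concretely Ng mod fg is (N mod f) g, and
  multiplying by the monic \<open>g\<close> only shifts the top coefficient. It puts residues at
  different places over a common denominator, which is how the residue theorem is applied
  below.\<close>

lemma res_mult_cancel:
  fixes f g N :: "'a::field poly"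
  assumes f: "lead_coeff f = 1" and g: "lead_coeff g = 1"
  shows "res (f * g) (N * g) = res f N"
proof (cases "degree f = 0")
  case True
  with f have "f = 1" by (auto elim!: degree_eq_zeroE)
  then show ?thesis by (simp add: res_eq_0_of_dvd)
next
  case False
  have nz: "f \<noteq> 0" "g \<noteq> 0" using f g by auto
  have "degree (N mod f) < degree f" using False nz degree_mod_less[of f N] by auto
  then have "coeff ((N mod f) * g) ((degree f - 1) + degree g) = coeff (N mod f) (degree f - 1) * coeff g (degree g)"
    by (intro coeff_mult_top) auto
  then show ?thesis using False nz g
    by (simp add: res_def mod_mult_mult2 degree_mult_eq)
qed

text \<open>The logarithmic derivative turns products into sums. This is the complete additivity
  that reduces the symbol of \<open>f\<close> to its irreducible factors.\<close>

lemma res_logderiv_mult: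
  fixes f g h :: "'a::field poly"
  assumes f: "lead_coeff f = 1" and g: "lead_coeff g = 1"
  shows "res (f * g) (h * pderiv (f * g)) = res f (h * pderiv f) + res g (h * pderiv g)"
proof -
  have "res (f * g) (h * pderiv (f * g)) = res (f * g) (h * pderiv f * g) + res (g * f) (h * pderiv g * f)"
    by (simp add: pderiv_mult algebra_simps flip: res_add)
  then show ?thesis by (simp only: res_mult_cancel f g)
qed

text \<open>\<open>N\<close> is invertible modulo \<open>P\<close>, so h N can be made congruent to
  c T^(deg P - 1), whose residue is c. With c = \<open>\<xi>\<close> it supplies the translations
  that change the sign of a character.\<close>

lemma exists_res_eq:
  fixes P N :: "'a::{finite,field} poly"
  assumes P: "lead_coeff P = 1" "irreducible P" and N: "\<not> P dvd N"
  shows "\<exists>h\<in>polys_below (degree P). res P (h * N) = c"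
proof -
  define n where "n = degree P"
  have n: "n > 0" unfolding n_def using irreducible_degree_pos[OF P(2)] .
  obtain g where g: "P dvd g * N - 1" using exists_inverse_mod_irreducible[OF P(2) N] by blast
  define h where "h = (g * monom c (n - 1)) mod P"
  have "h * N - monom c (n - 1) = (g * N - 1) * monom c (n - 1) - (g * monom c (n - 1) - h) * N"
    by (simp add: algebra_simps)
  moreover have "P dvd g * monom c (n - 1) - h" unfolding h_def by (rule dvd_minus_mod)
  ultimately have "P dvd h * N - monom c (n - 1)" using g by (simp add: dvd_diff)
  then have "res P (h * N) = res P (monom c (n - 1))" by (rule res_cong)
  also have "\<dots> = c"
  proof (subst res_degree_less)
    show "degree (monom c (n - 1)) < degree P"
      using degree_monom_le[of c "n - 1"] n unfolding n_def by linarith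
  qed (simp add: n_def)
  finally show ?thesis
    using mod_in_polys_below[of P] n unfolding h_def n_def by blast
qed

text \<open>The fibres are the pairs {x, \<open>\<tau>\<close> x}. It is applied to the
  Artin-Schreier map with \<open>\<tau>\<close> x = x + 1, over the field and modulo a
  prime.\<close>

lemma card_image_two_to_one:
  assumes "finite V" "\<And>x. x \<in> V \<Longrightarrow> \<tau> x \<in> V" "\<And>x. x \<in> V \<Longrightarrow> \<tau> x \<noteq> x"
    and "\<And>x y. x \<in> V \<Longrightarrow> y \<in> V \<Longrightarrow> w x = w y \<longleftrightarrow> y = x \<or> y = \<tau> x"
  shows "2 * card (w ` V) = card V"
proof -
  have "card V = (\<Sum>y\<in>w ` V. card {x \<in> V. w x = y})"
    using sum.image_gen[OF assms(1), of "\<lambda>_. 1 :: nat" w] by simp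
  also have "\<dots> = (\<Sum>y\<in>w ` V. 2)"
  proof (intro sum.cong refl)
    fix y assume "y \<in> w ` V"
    then obtain x where x: "x \<in> V" "y = w x" by auto
    have "{z \<in> V. w z = y} = {z \<in> V. w x = w z}" using x by auto
    also have "\<dots> = {z \<in> V. z = x \<or> z = \<tau> x}" using assms(4)[OF x(1)] by blast
    also have "\<dots> = {x, \<tau> x}" using assms(2) x by blast
    finally have "{z \<in> V. w z = y} = {x, \<tau> x}" .
    then show "card {z \<in> V. w z = y} = 2" using assms(3)[OF x(1)] by simp
  qed
  finally show ?thesis by simp
qed

text \<open>Substituting \<open>t x\<close> for \<open>x\<close> shows that the sum is its own
  negative. Every vanishing character sum below has this proof.\<close>

lemma sum_involution_eq_0:
  fixes \<phi> :: "'b \<Rightarrow> 'c::{idom,ring_char_0}"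
  assumes "\<And>x. x \<in> V \<Longrightarrow> t x \<in> V" "\<And>x. x \<in> V \<Longrightarrow> t (t x) = x"
    and "\<And>x. x \<in> V \<Longrightarrow> \<phi> (t x) = - \<phi> x"
  shows "sum \<phi> V = 0"
proof -
  have "sum \<phi> V = (\<Sum>x\<in>V. - \<phi> x)"
    by (rule sum.reindex_bij_witness[of _ t t]) (use assms in auto)
  then have "sum \<phi> V + sum \<phi> V = 0" by (simp add: sum_negf)
  then show ?thesis by (simp flip: mult_2)
qed

section \<open>Arithmetic in characteristic two and the Artin-Schreier map\<close>

lemma char_2_add_self:
  assumes "CHAR('b::comm_ring_1) = 2" shows "x + x = (0 :: 'b)"
proof -
  have "(2 :: 'b) = 0" using assms of_nat_CHAR[where 'a = 'b] by simp
  then show ?thesis by (metis mult_2 mult_zero_left)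
qed

lemma char_2_square_add:
  assumes "CHAR('b::comm_ring_1) = 2" shows "(x + y)\<^sup>2 = x\<^sup>2 + (y\<^sup>2 :: 'b)"
proof -
  have "(x + y)\<^sup>2 = x\<^sup>2 + y\<^sup>2 + (x * y + x * y)" by (simp add: power2_eq_square algebra_simps)
  then show ?thesis by (simp add: char_2_add_self[OF assms])
qed

text \<open>\<open>q\<close> is the size of the field as a real number, because the estimates are
  real. That \<open>\<xi>\<close> lies outside the range of \<open>wp\<close> makes the character
  \<open>\<psi>\<close> below nontrivial.\<close>

locale even_field =
  fixes \<xi> :: "'a::finite_field" and q :: real
  assumes real_card: "real CARD('a) = q"
    and card_power_2: "\<exists>m. CARD('a) = 2 ^ m"
    and \<xi>_notin: "\<xi> \<notin> range wp"
begin

text \<open>Translating the sum of all field elements by 1 leaves it unchanged, so the field size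
  vanishes in the field; the characteristic is therefore a prime dividing a power of 2.\<close>

lemma CHAR_2: "CHAR('a) = 2"
proof -
  obtain m where m: "CARD('a) = 2 ^ m" using card_power_2 by blast
  have "(\<Sum>x\<in>UNIV. x) = (\<Sum>x\<in>UNIV. x + 1 :: 'a)"
    by (rule sum.reindex_bij_witness[of _ "\<lambda>x. x + 1" "\<lambda>x. x - 1"]) auto
  then have "of_nat CARD('a) = (0 :: 'a)" by (simp add: sum.distrib)
  then have "CHAR('a) dvd 2 ^ m" unfolding m of_nat_eq_0_iff_char_dvd .
  moreover have "prime CHAR('a)" by simp
  ultimately show ?thesis by (metis prime_dvd_power primes_dvd_imp_eq two_is_prime_nat)
qed

lemma CHAR_poly_2: "CHAR('a poly) = 2"
  by (simp add: CHAR_2)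

lemmas add_self [simp] = char_2_add_self[OF CHAR_2] char_2_add_self[OF CHAR_poly_2]

lemmas square_add = char_2_square_add[OF CHAR_2] char_2_square_add[OF CHAR_poly_2]

lemma uminus_eq [simp]: "- x = (x :: 'a)" "- p = (p :: 'a poly)"
  by (rule minus_unique; simp)+

text \<open>Simplification removes all minus signs, so that equal summands meet and cancel. Steps
  that rely on divisibility of a difference switch this rule off.\<close>

lemma diff_eq_add [simp]: "x - y = (x + y :: 'a)" "p - r = (p + r :: 'a poly)"
  unfolding diff_conv_add_uminus by simp_all

lemma add_self_left [simp]: "x + (x + y) = (y :: 'a)" "p + (p + r) = (r :: 'a poly)"
  by (simp_all flip: add.assoc)

lemma exists_sqrt: "\<exists>y. x = (y :: 'a)\<^sup>2"
proof -
  obtain m where m: "CARD('a) = 2 ^ m" using card_power_2 by blast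
  have "m \<noteq> 0" using m card_finite_field_ge_2[where 'a = 'a] by (intro notI) simp
  then obtain k where k: "m = Suc k" by (cases m) auto
  have "x = x ^ CARD('a)" by (simp add: finite_field_power_card_eq_same)
  also have "\<dots> = (x ^ 2 ^ k)\<^sup>2" by (simp add: m k power_mult[symmetric] mult.commute)
  finally show ?thesis by blast
qed

lemma pderiv_square [simp]: "pderiv (p\<^sup>2) = (0 :: 'a poly)"
  by (simp add: power2_eq_square pderiv_mult mult.commute)

text \<open>Every field element is a square and squaring is additive, so the even part of a
  polynomial is a square and the odd part is T times a square. Passing from p to c + T p exchanges
  the two roles.\<close>

lemma even_odd_decomp: "\<exists>A B. p = A\<^sup>2 + [:0, 1:] * (B :: 'a poly)\<^sup>2"
proof (induction p)
  case 0
  show ?case by (intro exI[of _ 0]) simp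
next
  case (pCons c p)
  then obtain A B where p: "p = A\<^sup>2 + [:0, 1:] * B\<^sup>2" by blast
  obtain s where s: "c = s\<^sup>2" using exists_sqrt by blast
  have "pCons c p = [:s:]\<^sup>2 + [:0, 1:] * p" by (simp add: s power2_eq_square)
  also have "\<dots> = ([:s:] + [:0, 1:] * B)\<^sup>2 + [:0, 1:] * A\<^sup>2"
    by (simp only: square_add p power_mult_distrib) (simp add: algebra_simps power2_eq_square)
  finally show ?case by blast
qed

lemma pderiv_decomp: "pderiv (A\<^sup>2 + [:0, 1:] * B\<^sup>2) = (B :: 'a poly)\<^sup>2"
  by (simp add: pderiv_add pderiv_mult pderiv_pCons del: mult_pCons_left)

lemma coeff_square: "coeff ((p :: 'a poly)\<^sup>2) n = (if even n then (coeff p (n div 2))\<^sup>2 else 0)"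
proof (induction p arbitrary: n)
  case (pCons c p)
  have "pCons c p = [:c:] + pCons 0 p" by simp
  then have "(pCons c p)\<^sup>2 = [:c:]\<^sup>2 + (pCons 0 p)\<^sup>2" by (simp only: square_add)
  also have "\<dots> = pCons (c\<^sup>2) (pCons 0 (p\<^sup>2))" by (simp add: power2_eq_square)
  finally show ?case using pCons.IH by (auto simp: coeff_pCons split: nat.splits)
qed simp

text \<open>This is how the Cartier operator acts on residues. With r = N mod f, the square of N is
  congruent to that of r modulo the square of f. The square of r has only even-indexed coefficients,
  while the residue reads the odd index 2 deg f - 1; a factor T moves the coefficient of index 2(deg
  f - 1) there, and it is the square of the top coefficient of r.\<close>

lemma res_square:
  fixes f N :: "'a poly"
  assumes f: "lead_coeff f = 1" "degree f > 0"
  shows "res (f\<^sup>2) (N\<^sup>2) = 0" "res (f\<^sup>2) ([:0, 1:] * N\<^sup>2) = (res f N)\<^sup>2"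
proof -
  define r where "r = N mod f"
  have "f \<noteq> 0" using f by auto
  have r: "degree r < degree f" unfolding r_def
    using degree_mod_less[OF \<open>f \<noteq> 0\<close>, of N] f by auto
  have "N = f * (N div f) + r" by (simp add: r_def)
  then have "N\<^sup>2 = f\<^sup>2 * (N div f)\<^sup>2 + r\<^sup>2" by (metis square_add(2) power_mult_distrib)
  then have "N\<^sup>2 - r\<^sup>2 = f\<^sup>2 * (N div f)\<^sup>2" by (simp del: diff_eq_add)
  then have N: "f\<^sup>2 dvd N\<^sup>2 - r\<^sup>2" by (simp del: diff_eq_add)
  have deg: "degree (f\<^sup>2) = 2 * degree f" using \<open>f \<noteq> 0\<close> by (simp add: degree_power_eq)
  have deg_r: "degree (r\<^sup>2) \<le> 2 * degree r" by (metis degree_power_le mult.commute)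
  show "res (f\<^sup>2) (N\<^sup>2) = 0"
  proof -
    have "res (f\<^sup>2) (N\<^sup>2) = res (f\<^sup>2) (r\<^sup>2)" using N by (rule res_cong)
    also have "\<dots> = coeff (r\<^sup>2) (2 * degree f - 1)"
      using r deg_r by (subst res_degree_less) (auto simp: deg)
    finally show ?thesis using f by (simp add: coeff_square)
  qed
  show "res (f\<^sup>2) ([:0, 1:] * N\<^sup>2) = (res f N)\<^sup>2"
  proof -
    have "f\<^sup>2 dvd [:0, 1:] * (N\<^sup>2 - r\<^sup>2)" using N by (rule dvd_mult)
    then have "res (f\<^sup>2) ([:0, 1:] * N\<^sup>2) = res (f\<^sup>2) ([:0, 1:] * r\<^sup>2)"
      by (intro res_cong) (simp only: right_diff_distrib)
    also have "\<dots> = coeff ([:0, 1:] * r\<^sup>2) (2 * degree f - 1)"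
    proof (subst res_degree_less)
      have "degree ([:0, 1:] * r\<^sup>2) \<le> 1 + 2 * degree r"
        using degree_mult_le[of "[:0, 1:]" "r\<^sup>2"] deg_r by simp
      then show "degree ([:0, 1:] * r\<^sup>2) < degree (f\<^sup>2)" using r by (simp add: deg)
    qed (simp add: deg)
    also have "\<dots> = coeff (r\<^sup>2) (2 * (degree f - 1))"
      using f by (cases "degree f") (auto simp: coeff_pCons)
    also have "\<dots> = (res f N)\<^sup>2"
      unfolding coeff_square by (simp add: res_def r_def)
    finally show ?thesis .
  qed
qed

lemma wp_add: "wp (x + y) = wp x + (wp y :: 'a)" "wp (p + r) = wp p + (wp r :: 'a poly)"
  unfolding wp_def square_add by (simp_all add: add_ac)

lemma wp_eq_iff: "wp x = wp y \<longleftrightarrow> y = x \<or> y = x + (1 :: 'a)"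
proof -
  have "wp x - wp y = (x + y) * (x + y + 1)"
    using wp_add(1)[of x y] by (simp add: wp_def power2_eq_square algebra_simps)
  then have "wp x = wp y \<longleftrightarrow> x - y = 0 \<or> x + 1 - y = 0"
    by (metis (no_types, lifting) right_minus_eq mult_eq_0_iff diff_eq_add(1) add.commute add.left_commute)
  then show ?thesis by (auto simp del: diff_eq_add)
qed

lemma card_range_wp: "2 * card (range (wp :: 'a \<Rightarrow> 'a)) = CARD('a)"
  by (rule card_image_two_to_one[where \<tau> = "\<lambda>x. x + 1"]) (auto simp: wp_eq_iff)

text \<open>By \<open>card_range_wp\<close> the range of \<open>wp\<close> is a subgroup of index
  two, so its complement is the single coset through \<open>c\<close>.\<close>

lemma add_notin_range_wp:
  assumes "c \<notin> range wp" "d \<notin> range wp" shows "c + d \<in> range (wp :: 'a \<Rightarrow> 'a)"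
proof -
  let ?W = "range (wp :: 'a \<Rightarrow> 'a)"
  have sub: "x + y \<in> ?W" if "x \<in> ?W" "y \<in> ?W" for x y
    using that by (auto simp flip: wp_add)
  have "(+) c ` ?W \<subseteq> UNIV - ?W"
  proof
    fix y assume "y \<in> (+) c ` ?W"
    then obtain w where w: "w \<in> ?W" "y = c + w" by blast
    have "y \<notin> ?W"
    proof
      assume "y \<in> ?W"
      from sub[OF this w(1)] have "c \<in> ?W" by (simp add: w(2) add.assoc)
      with assms show False by simp
    qed
    then show "y \<in> UNIV - ?W" by simp
  qed
  moreover have "card ((+) c ` ?W) = card (UNIV - ?W)"
    using card_range_wp by (simp add: card_image card_Diff_subset)
  ultimately have "(+) c ` ?W = UNIV - ?W" by (intro card_subset_eq) auto
  then obtain w where "w \<in> ?W" "d = c + w" using assms(2) by blast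
  then show ?thesis by (simp add: add_self_left)
qed

text \<open>This is \<open>(-1)\<close> to the power of the absolute trace of \<open>c\<close>.\<close>

definition \<psi> :: "'a \<Rightarrow> real" where
  "\<psi> c = (if c \<in> range wp then 1 else - 1)"

lemma \<psi>_add: "\<psi> (c + d) = \<psi> c * \<psi> d"
proof -
  have sub: "x + y \<in> range wp" if "x \<in> range wp" "y \<in> range wp" for x y :: 'a
    using that by (auto simp flip: wp_add)
  have "c + d \<notin> range wp" if "c \<in> range wp" "d \<notin> range wp" for c d :: 'a
    using sub[of "c + d" c] that by (auto simp: add_ac)
  from this[of c d] this[of d c] sub add_notin_range_wp show ?thesis
    by (auto simp: \<psi>_def add.commute)
qed

lemma \<psi>_wp [simp]: "\<psi> (wp c) = 1" and \<psi>_\<xi> [simp]: "\<psi> \<xi> = - 1" and abs_\<psi>: "\<bar>\<psi> c\<bar> = 1"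
  and \<psi>_nonzero [simp]: "\<psi> c \<noteq> 0"
  using \<xi>_notin by (auto simp: \<psi>_def)

lemma \<psi>_0 [simp]: "\<psi> 0 = 1"
  using \<psi>_wp[of 0] by (simp add: wp_def)

text \<open>Separability: by degrees Q | Q' forces Q' = 0, and then \<open>Q\<close> is a square,
  which is not irreducible.\<close>

lemma pderiv_irreducible_not_dvd:
  assumes "irreducible (Q :: 'a poly)" shows "\<not> Q dvd pderiv Q"
proof
  assume dvd: "Q dvd pderiv Q"
  have "pderiv Q = 0"
  proof (rule ccontr)
    assume "pderiv Q \<noteq> 0"
    then have "degree Q \<le> degree (pderiv Q)" using dvd dvd_imp_degree_le by blast
    with degree_pderiv_less[OF irreducible_degree_pos[OF assms]] show False by simp
  qed
  obtain A B where Q: "Q = A\<^sup>2 + [:0, 1:] * B\<^sup>2" using even_odd_decomp by blast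
  then have "B\<^sup>2 = 0" using \<open>pderiv Q = 0\<close> pderiv_decomp by metis
  then have "Q = A * A" using Q by (simp add: power2_eq_square)
  then have "is_unit A" using assms by (metis irreducibleD)
  then show False using \<open>Q = A * A\<close> assms by (auto simp: irreducible_def)
qed

text \<open>This works because the derivative of a polynomial is a square in characteristic two.\<close>

lemma res_wp_logderiv:
  fixes Q X :: "'a poly"
  assumes Q: "lead_coeff Q = 1" "degree Q > 0"
  shows "res Q (wp X * pderiv Q) = wp (res Q (X * pderiv Q))"
proof -
  obtain A B where AB: "Q = A\<^sup>2 + [:0, 1:] * B\<^sup>2" using even_odd_decomp by blast
  then have B: "pderiv Q = B\<^sup>2" using pderiv_decomp by metis
  \<comment> \<open>Extending the fraction by \<open>Q\<close> makes the denominator a square.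
    Writing the new factor \<open>Q\<close> in the numerator as A^2 + T B^2 splits the numerator
    into a square, with residue 0, and T times a square, so that \<open>res_square\<close> applies
    to both.\<close>
  have "res Q (X\<^sup>2 * B\<^sup>2) = res (Q\<^sup>2) (X\<^sup>2 * B\<^sup>2 * Q)"
    unfolding power2_eq_square[of Q] using res_mult_cancel[OF Q(1) Q(1)] by simp
  also have "X\<^sup>2 * B\<^sup>2 * Q = (X * B * A)\<^sup>2 + [:0, 1:] * (X * B\<^sup>2)\<^sup>2"
    by (subst AB) (simp only: power2_eq_square distrib_left mult_ac)
  also have "res (Q\<^sup>2) \<dots> = (res Q (X * B\<^sup>2))\<^sup>2"
    by (simp only: res_add res_square[OF Q] add_0)
  finally show ?thesis by (simp add: wp_def B distrib_right res_add)
qed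

text \<open>Modulo \<open>Q\<close> the image of \<open>wp\<close> lies in the kernel of the
  character \<open>e\<close>, by \<open>res_wp_logderiv\<close>. Both contain half of all residues:
  \<open>wp\<close> is two-to-one because wp x - wp y = (x - y)(x + 1 - y) and \<open>Q\<close> is
  prime, and \<open>e\<close> is nontrivial because Q' is invertible modulo \<open>Q\<close>. Hence
  they agree.\<close>

lemma artin_schreier_solvable_iff:
  fixes Q h :: "'a poly"
  assumes Q: "lead_coeff Q = 1" "irreducible Q"
  shows "(\<exists>X. Q dvd wp X - h) \<longleftrightarrow> \<psi> (res Q (h * pderiv Q)) = 1"
proof -
  define n where "n = degree Q"
  have n: "n > 0" unfolding n_def using irreducible_degree_pos[OF Q(2)] .
  define e where "e h = \<psi> (res Q (h * pderiv Q))" for h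
  have e_add: "e (x + y) = e x * e y" for x y
    by (simp add: e_def distrib_right res_add \<psi>_add)
  have e_wp: "e (wp X) = 1" for X
    using res_wp_logderiv[OF Q(1)] n by (simp add: e_def n_def)
  have e_cong: "e x = e y" if "Q dvd x - y" for x y
  proof -
    have "Q dvd (x - y) * pderiv Q" using that by (rule dvd_mult2)
    then have "res Q (x * pderiv Q) = res Q (y * pderiv Q)"
      by (intro res_cong) (simp only: left_diff_distrib)
    then show ?thesis by (simp add: e_def)
  qed
  have Q_mod: "Q dvd x - x mod Q" for x by (rule dvd_minus_mod)
  let ?V = "polys_below n :: 'a poly set"
  have mod_V: "x mod Q \<in> ?V" for x
    using mod_in_polys_below n unfolding n_def by blast
  have V_dvd: "x = 0" if "x \<in> ?V" "Q dvd x" for x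
    using that by (auto simp: polys_below_iff n_def dest: dvd_imp_degree_le)
  have one_V: "1 \<in> ?V" using n by (simp add: polys_below_iff)
  let ?w = "\<lambda>X. wp X mod Q"
  have card_w: "2 * card (?w ` ?V) = card ?V"
  proof (rule card_image_two_to_one[where \<tau> = "\<lambda>x. x + 1"])
    fix x y assume xy: "x \<in> ?V" "y \<in> ?V"
    have "wp x - wp y = (x - y) * (x + 1 - y)"
      using wp_add(2)[of x y] by (simp add: wp_def power2_eq_square algebra_simps)
    then have "?w x = ?w y \<longleftrightarrow> Q dvd (x - y) * (x + 1 - y)"
      by (simp only: mod_eq_dvd_iff)
    also have "\<dots> \<longleftrightarrow> Q dvd x - y \<or> Q dvd x + 1 - y"
      by (rule prime_elem_dvd_mult_iff[OF field_poly_irreducible_imp_prime[OF Q(2)]])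
    also have "Q dvd x - y \<longleftrightarrow> x - y = 0"
      using V_dvd polys_below_diff[OF xy] by auto
    also have "Q dvd x + 1 - y \<longleftrightarrow> x + 1 - y = 0"
      using V_dvd polys_below_diff[OF polys_below_add[OF xy(1) one_V] xy(2)] by auto
    finally show "?w x = ?w y \<longleftrightarrow> y = x \<or> y = x + 1"
      by (auto simp del: diff_eq_add)
  qed (use one_V in \<open>auto intro: polys_below_add\<close>)
  let ?K = "{x \<in> ?V. e x = 1}"
  have card_K: "2 * card ?K = card ?V"
  proof -
    obtain h0 where h0_V: "h0 \<in> ?V" and "res Q (h0 * pderiv Q) = \<xi>"
      unfolding n_def using exists_res_eq[OF Q pderiv_irreducible_not_dvd[OF Q(2)]] by blast
    then have h0: "e h0 = - 1" by (simp add: e_def)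
    have "sum e ?V = 0"
      by (rule sum_involution_eq_0[where t = "\<lambda>x. x + h0"])
        (use h0_V in \<open>auto simp: e_add h0 add.assoc intro!: polys_below_add\<close>)
    moreover have "sum e ?V = (\<Sum>x\<in>?V. (if e x = 1 then 2 else 0) - 1)"
      by (intro sum.cong refl) (auto simp: e_def \<psi>_def)
    moreover have "\<dots> = 2 * real (card ?K) - real (card ?V)"
      by (simp add: sum_subtractf flip: sum.inter_filter)
    ultimately have "real (2 * card ?K) = real (card ?V)" by simp
    then show ?thesis by (simp only: of_nat_eq_iff)
  qed
  have "?w ` ?V \<subseteq> ?K" using mod_V e_cong[OF Q_mod] e_wp by force
  moreover have "card (?w ` ?V) = card ?K" using card_w card_K by simp
  ultimately have eq: "?w ` ?V = ?K" by (intro card_subset_eq) auto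
  show ?thesis
  proof
    assume "\<exists>X. Q dvd wp X - h"
    then obtain X where "Q dvd wp X - h" by blast
    from e_cong[OF this] e_wp show "\<psi> (res Q (h * pderiv Q)) = 1" by (simp add: e_def)
  next
    assume "\<psi> (res Q (h * pderiv Q)) = 1"
    then have "h mod Q \<in> ?K" using mod_V e_cong[OF Q_mod] by (simp add: e_def)
    then obtain X where "h mod Q = wp X mod Q" using eq by blast
    then have "Q dvd wp X - h" by (simp only: mod_eq_dvd_iff[symmetric])
    then show "\<exists>X. Q dvd wp X - h" ..
  qed
qed

end

subsection \<open>Reciprocity and vanishing character sums\<close>

lemma coprime_irreducible_iff:
  "irreducible P \<Longrightarrow> coprime f P \<longleftrightarrow> \<not> P dvd f" for P f :: "'a::field poly"
proof
  assume P: "irreducible P" "\<not> P dvd f"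
  show "coprime f P"
  proof (rule coprimeI)
    fix c assume "c dvd f" "c dvd P"
    with P show "is_unit c" using irreducibleD'[OF P(1)] dvd_trans by blast
  qed
next
  assume P: "irreducible P" and "coprime f P"
  then show "\<not> P dvd f" using coprime_common_divisor[of f P P] by (auto simp: irreducible_def)
qed

text \<open>Shows that the \<open>THE\<close> in \<open>denominator\<close> picks \<open>P\<close>:
  another reduced monic denominator is P k, and then k also divides its numerator, so k is a monic
  unit.\<close>

lemma denominator_Fract:
  fixes P N :: "'a::field poly"
  assumes P: "lead_coeff P = 1" "irreducible P" and N: "\<not> P dvd N"
  shows "denominator (Fract N P) = P"
  unfolding denominator_def
proof (rule the_equality)
  have "coprime N P" using N P coprime_irreducible_iff by blast
  with P show "lead_coeff P = 1 \<and> (\<exists>a. coprime a P \<and> Fract N P = Fract a P)" by blast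
next
  fix D assume "lead_coeff D = 1 \<and> (\<exists>a. coprime a D \<and> Fract N P = Fract a D)"
  then obtain M where D: "lead_coeff D = 1" "coprime M D" "Fract N P = Fract M D" by blast
  have nz: "P \<noteq> 0" "D \<noteq> 0" using P D by auto
  with D have eq: "N * D = M * P" by (simp add: eq_fract)
  then have "P dvd D"
    using prime_elem_dvd_multD[OF field_poly_irreducible_imp_prime[OF P(2)]] N by (metis dvd_triv_right)
  then obtain k where k: "D = P * k" by (rule dvdE)
  with eq nz have "M = N * k" by simp
  then have "is_unit k" using D(2) k by (meson coprime_common_divisor dvd_triv_right)
  moreover have "lead_coeff k = 1" using D(1) P(1) k by (metis lead_coeff_mult mult_1)
  ultimately have "k = 1" by (auto elim!: is_unit_polyE)
  with k show "D = P" by simp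
qed

lemma inverse_mod_not_dvd:
  fixes P f g :: "'a::field poly"
  assumes "irreducible P" "P dvd g * f - 1" shows "\<not> P dvd g" "\<not> P dvd f"
proof -
  have "\<not> P dvd g * f"
  proof
    assume "P dvd g * f"
    then have "P dvd g * f - (g * f - 1)" using assms(2) by (rule dvd_diff)
    then show False using assms(1) by (simp add: irreducible_def)
  qed
  then show "\<not> P dvd g" "\<not> P dvd f" by (auto intro: dvd_mult dvd_mult2)
qed

text \<open>\<open>P\<close> is a unit in the localization at \<open>Q\<close>, so the congruence
  may be multiplied by it.\<close>

lemma cong_at_Fract_iff:
  fixes P Q N y :: "'a::field poly"
  assumes Q: "irreducible Q" and P: "\<not> Q dvd P"
  shows "cong_at Q (to_fract y) (Fract N P) \<longleftrightarrow> Q dvd y * P - N"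
proof -
  have P0: "P \<noteq> 0" using P by auto
  note prime = field_poly_irreducible_imp_prime[OF Q]
  have eq: "to_fract y - Fract N P = Fract (y * P - N) P"
    using P0 by (simp add: to_fract_def)
  show ?thesis
  proof
    assume "cong_at Q (to_fract y) (Fract N P)"
    then obtain c d where d: "\<not> Q dvd d" and "to_fract y - Fract N P = to_fract Q * Fract c d"
      unfolding cong_at_def integral_at_def by blast
    then have "Fract (y * P - N) P = Fract (Q * c) d" by (simp only: eq) (simp add: to_fract_def)
    moreover have "d \<noteq> 0" using d by auto
    ultimately have "(y * P - N) * d = Q * c * P" using P0 by (simp add: eq_fract)
    then have "Q dvd (y * P - N) * d" by (metis dvd_triv_left mult.assoc)
    then show "Q dvd y * P - N" using d prime_elem_dvd_multD[OF prime] by blast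
  next
    assume "Q dvd y * P - N"
    then obtain k where "y * P - N = Q * k" by (rule dvdE)
    then have "to_fract y - Fract N P = to_fract Q * Fract k P"
      by (simp only: eq) (simp add: to_fract_def)
    with P show "cong_at Q (to_fract y) (Fract N P)"
      unfolding cong_at_def integral_at_def by blast
  qed
qed

context even_field
begin

text \<open>\<open>h\<close> represents N/P modulo \<open>f\<close>, hence modulo every prime factor
  of \<open>f\<close>. The residue expression is completely additive in \<open>f\<close> and agrees
  with \<open>hasse_prime\<close> on primes by the Artin-Schreier criterion.\<close>

lemma hasse_eq_residue:
  fixes P N f h :: "'a poly"
  assumes P: "P \<noteq> 0" "\<And>Q. irreducible Q \<Longrightarrow> Q dvd f \<Longrightarrow> \<not> Q dvd P" and f: "lead_coeff f = 1"
    and h: "f dvd h * P - N"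
  shows "hasse (Fract N P) f = (if \<psi> (res f (h * pderiv f)) = 1 then 0 else 1)"
proof -
  define G :: "'a poly \<Rightarrow> bit" where "G f = (if \<psi> (res f (h * pderiv f)) = 1 then 0 else 1)" for f
  have "G (f * g) = G f + G g" if "lead_coeff f = 1" "lead_coeff g = 1" for f g
    using that by (auto simp: G_def res_logderiv_mult \<psi>_add) (auto simp: \<psi>_def split: if_splits)
  moreover have "G 1 = 0" by (simp add: G_def res_eq_0_of_dvd)
  ultimately have "G f = (\<Sum>Q | lead_coeff Q = 1 \<and> irreducible Q \<and> Q dvd f. of_nat (exponent Q f) * G Q)"
    using f by (intro completely_additive_eq)
  also have "\<dots> = hasse (Fract N P) f"
    unfolding hasse_def
  proof (intro sum.cong refl arg_cong2[where f = "(*)"])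
    fix Q assume "Q \<in> {Q. lead_coeff Q = 1 \<and> irreducible Q \<and> Q dvd f}"
    then have Q: "lead_coeff Q = 1" "irreducible Q" "Q dvd f" by auto
    have "Q dvd y * P - N \<longleftrightarrow> Q dvd y - h" for y
    proof -
      have "Q dvd h * P - N" using Q(3) h by (rule dvd_trans)
      then have "Q dvd y * P - N \<longleftrightarrow> Q dvd (y * P - N) - (h * P - N)"
        using dvd_diff_left_iff by blast
      also have "(y * P - N) - (h * P - N) = (y - h) * P" by (simp add: algebra_simps del: diff_eq_add)
      also have "Q dvd (y - h) * P \<longleftrightarrow> Q dvd y - h"
        using P(2)[OF Q(2,3)] prime_elem_dvd_mult_iff[OF field_poly_irreducible_imp_prime[OF Q(2)]] by blast
      finally show ?thesis .
    qed
    then have "(\<exists>X. cong_at Q (to_fract (wp X)) (Fract N P)) \<longleftrightarrow> (\<exists>X. Q dvd wp X - h)"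
      using cong_at_Fract_iff[OF Q(2) P(2)[OF Q(2,3)]] by simp
    then show "G Q = hasse_prime (Fract N P) Q"
      unfolding G_def hasse_prime_def artin_schreier_solvable_iff[OF Q(1,2)] by simp
  qed
  finally show ?thesis by (simp add: G_def)
qed

section \<open>The two local factors of the character\<close>

definition inv_mod :: "'a poly \<Rightarrow> 'a poly \<Rightarrow> 'a poly" where
  "inv_mod P f = (SOME g. P dvd g * f - 1)"

lemma inv_mod:
  assumes "irreducible P" "\<not> P dvd f" shows "P dvd inv_mod P f * f - 1"
  unfolding inv_mod_def by (rule someI_ex) (rule exists_inverse_mod_irreducible[OF assms])

text \<open>The contributions of \<open>P\<close> and of infinity to the character of \<open>u = a / P + F\<close>.\<close>

definition chi_fin :: "'a poly \<Rightarrow> 'a poly \<Rightarrow> 'a poly \<Rightarrow> real" where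
  "chi_fin P a f = (if P dvd f then 0 else \<psi> (res P (a * inv_mod P f * pderiv f)))"

definition chi_inf :: "'a poly \<Rightarrow> 'a poly \<Rightarrow> real" where
  "chi_inf F f = \<psi> (res f (F * pderiv f))"

text \<open>Independence of the inverse chosen by \<open>inv_mod\<close>. In the involutions below,
  \<open>f\<close> and its translate are congruent modulo \<open>P\<close>, so one inverse
  \<open>g\<close> can serve both.\<close>

lemma chi_fin_eq:
  assumes P: "irreducible P" and g: "P dvd g * f - 1"
  shows "chi_fin P a f = \<psi> (res P (a * g * pderiv f))"
proof -
  note nd = inverse_mod_not_dvd(2)[OF P g]
  note i = inv_mod[OF P nd]
  have "a * inv_mod P f * pderiv f - a * g * pderiv f
      = (a * pderiv f) * (g * (inv_mod P f * f - 1) - inv_mod P f * (g * f - 1))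
        * (- 1)"
    by (simp add: algebra_simps)
  then have "P dvd a * inv_mod P f * pderiv f - a * g * pderiv f"
    using i g by (simp del: diff_eq_add uminus_eq add: dvd_diff)
  then have "res P (a * inv_mod P f * pderiv f) = res P (a * g * pderiv f)" by (rule res_cong)
  with nd show ?thesis by (simp add: chi_fin_def)
qed

text \<open>Reciprocity: by the residue theorem the sum of the residues of \<open>u df / f\<close> over the zeros of
  \<open>f\<close> is minus the sum of those at \<open>P\<close> and at infinity.\<close>

lemma hasse_char_eq:
  fixes P a F f :: "'a poly"
  assumes P: "lead_coeff P = 1" "irreducible P" and a: "a \<in> polys_below (degree P)" "a \<noteq> 0"
    and f: "lead_coeff f = 1"
  shows "of_int (hasse_char (Fract a P + to_fract F) f) = chi_fin P a f * chi_inf F f"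
proof -
  define N where "N = a + F * P"
  have P0: "P \<noteq> 0" "degree P > 0" using P irreducible_degree_pos by auto
  have u: "Fract a P + to_fract F = Fract N P"
    using P0 by (simp add: N_def to_fract_def)
  have "\<not> P dvd a" using a by (auto simp: polys_below_iff dest: dvd_imp_degree_le)
  then have "\<not> P dvd N" unfolding N_def by (simp add: dvd_add_left_iff)
  then have den: "denominator (Fract N P) = P" using denominator_Fract P by blast
  show ?thesis
  proof (cases "P dvd f")
    case True
    then show ?thesis
      by (simp add: u hasse_char_def den coprime_irreducible_iff[OF P(2)] chi_fin_def)
  next
    case False
    define g where "g = inv_mod P f"
    have "P dvd g * f - 1" unfolding g_def using inv_mod[OF P(2) False] .
    then obtain l where l: "g * f - 1 = P * l" by (rule dvdE)
    \<comment> \<open>Modulo \<open>f\<close> the equation for \<open>l\<close> reads P l = -1, and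
      -1 = 1 here. So \<open>l\<close> inverts \<open>P\<close> modulo \<open>f\<close>, and
      \<open>h\<close> represents N/P.\<close>
    define h where "h = l * N"
    have "h * P = N * (g * f - 1)" unfolding l h_def by (simp add: mult_ac)
    then have hP: "h * P = N + g * f * N" by (simp add: algebra_simps)
    then have "f dvd h * P - N" by (simp add: add_ac)
    moreover have "\<not> Q dvd P" if Q: "irreducible Q" "Q dvd f" for Q
    proof
      assume "Q dvd P"
      then have "Q dvd g * f - (g * f - 1)" using Q(2) unfolding l by (intro dvd_diff dvd_mult2 dvd_mult)
      then have "is_unit Q" by (simp del: diff_eq_add)
      with Q show False by (simp add: irreducible_def)
    qed
    ultimately have "hasse (Fract N P) f = (if \<psi> (res f (h * pderiv f)) = 1 then 0 else 1)"
      using P0 f by (intro hasse_eq_residue) auto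
    then have *: "of_int (hasse_char (Fract N P) f) = \<psi> (res f (h * pderiv f))"
      using False by (auto simp: hasse_char_def den coprime_irreducible_iff[OF P(2)] \<psi>_def)
    have "res f (h * pderiv f) = res (f * P) (h * pderiv f * P)"
      by (simp add: res_mult_cancel f P)
    also have "h * pderiv f * P = a * pderiv f + F * pderiv f * P + a * g * pderiv f * f
        + (f * P) * (F * g * pderiv f)"
      using arg_cong[OF hP, of "\<lambda>x. x * pderiv f"] by (simp add: N_def algebra_simps)
    also have "res (f * P) \<dots> = res (f * P) (a * pderiv f) + res (f * P) (F * pderiv f * P)
        + res (P * f) (a * g * pderiv f * f)"
      by (simp add: res_add res_eq_0_of_dvd mult.commute)
    also have "\<dots> = res (f * P) (a * pderiv f) + res f (F * pderiv f) + res P (a * g * pderiv f)"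
      by (simp only: res_mult_cancel f P)
    \<comment> \<open>The degree of a f' is at most deg(f P) - 2, so the expansion of a f'/(f P) at
      infinity has no 1/T term: its residues at the zeros of f P cancel.\<close>
    also have "res (f * P) (a * pderiv f) = 0"
    proof (cases "degree f = 0")
      case True
      then show ?thesis by (auto elim!: degree_eq_zeroE simp: pderiv_pCons res_eq_0_of_dvd)
    next
      case f0: False
      have "degree (pderiv f) < degree f" using f0 degree_pderiv_less by blast
      moreover have "degree a < degree P" using a by (simp add: polys_below_iff)
      moreover have "degree (a * pderiv f) \<le> degree a + degree (pderiv f)" by (rule degree_mult_le)
      moreover have "degree (f * P) = degree f + degree P" using P0 f by (subst degree_mult_eq) auto
      ultimately show ?thesis by (subst res_degree_less) (auto simp: coeff_eq_0)
    qed
    finally show ?thesis unfolding u * using False by (simp add: \<psi>_add chi_inf_def chi_fin_def g_def mult.commute)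
  qed
qed

lemma chi_inf_add: "chi_inf (F + E) f = chi_inf F f * chi_inf E f"
  by (simp add: chi_inf_def distrib_right res_add \<psi>_add)

lemma abs_chi_inf: "\<bar>chi_inf F f\<bar> = 1"
  by (simp add: chi_inf_def abs_\<psi>)

lemma coeff_pderiv_monic: "f \<in> monics n \<Longrightarrow> n > 0 \<Longrightarrow> coeff (pderiv f) (n - 1) = of_nat n"
  for f :: "'a poly"
  by (simp add: coeff_pderiv monics_iff)

lemma of_nat_parity: "(of_nat n :: 'a) = (if even n then 0 else 1)"
  by (induction n) auto

text \<open>Up to sign the residue of df/f at infinity is deg f, so a constant only sees the parity
  of the degree.\<close>

lemma chi_inf_const:
  assumes f: "f \<in> monics n" shows "chi_inf [:\<alpha>:] f = (if even n then 1 else \<psi> \<alpha>)"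
proof (cases "n = 0")
  case True
  with f show ?thesis by (simp add: monics_0 chi_inf_def res_eq_0_of_dvd)
next
  case False
  have d: "degree f = n" using f by (simp add: monics_def)
  then have "degree (pderiv f) < n" using False degree_pderiv_less by auto
  then have "res f ([:\<alpha>:] * pderiv f) = \<alpha> * coeff (pderiv f) (n - 1)"
    by (simp add: res_smult res_degree_less d)
  also have "coeff (pderiv f) (n - 1) = of_nat n" using coeff_pderiv_monic[OF f] False by simp
  finally show ?thesis by (simp add: chi_inf_def of_nat_parity)
qed

lemma sum_additive_character:
  fixes P N :: "'a poly"
  assumes P: "lead_coeff P = 1" "irreducible P"
  shows "(\<Sum>a\<in>polys_below (degree P). \<psi> (res P (a * N)))
       = (if P dvd N then q ^ degree P else 0)"
proof (cases "P dvd N")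
  case True
  then show ?thesis by (simp add: res_eq_0_of_dvd card_polys_below real_card)
next
  case False
  then obtain h where h: "h \<in> polys_below (degree P)" "res P (h * N) = \<xi>"
    using exists_res_eq[OF P] by blast
  have "(\<Sum>a\<in>polys_below (degree P). \<psi> (res P (a * N))) = 0"
    by (rule sum_involution_eq_0[where t = "\<lambda>x. x + h"])
      (use h in \<open>auto simp: add.assoc distrib_right res_add \<psi>_add intro!: polys_below_add\<close>)
  with False show ?thesis by simp
qed

text \<open>Orthogonality over all residues gives q^(deg P) or 0. The family omits a = 0, where the
  character is 1, whence the shift by -1.\<close>

lemma sum_chi_fin:
  fixes P f :: "'a poly"
  assumes P: "lead_coeff P = 1" "irreducible P"
  shows "(\<Sum>a\<in>polys_below (degree P) - {0}. chi_fin P a f)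
       = (if P dvd f then 0 else if P dvd pderiv f then q ^ degree P - 1 else - 1)"
proof (cases "P dvd f")
  case True
  then show ?thesis by (simp add: chi_fin_def)
next
  case False
  have "P dvd inv_mod P f * pderiv f \<longleftrightarrow> P dvd pderiv f"
  proof -
    have "\<not> P dvd inv_mod P f" using inverse_mod_not_dvd(1)[OF P(2) inv_mod[OF P(2) False]] .
    then show ?thesis
      using prime_elem_dvd_mult_iff[OF field_poly_irreducible_imp_prime[OF P(2)]] by blast
  qed
  with sum_additive_character[OF P, of "inv_mod P f * pderiv f"]
  have "(\<Sum>a\<in>polys_below (degree P). chi_fin P a f)
      = (if P dvd pderiv f then q ^ degree P else 0)"
    using False by (simp add: chi_fin_def mult.assoc)
  moreover have "chi_fin P 0 f = 1" using False by (simp add: chi_fin_def res_eq_0_of_dvd)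
  ultimately show ?thesis using False by (subst sum_diff1) simp_all
qed

text \<open>The involution adds P c with c congruent to f w modulo \<open>P\<close>. It preserves f
  modulo \<open>P\<close>, and modulo \<open>P\<close> it adds c P' to f'; so f'/f changes by w P',
  independently of f. Choosing \<open>w\<close> so that a w P' has residue \<open>\<xi>\<close> at
  \<open>P\<close> reverses the sign. Since P c has degree below 2 deg P, the polynomial stays monic
  of degree \<open>n\<close>, and the constant at infinity contributes a common factor.\<close>

lemma sum_char_const_eq_0:
  fixes P a :: "'a poly"
  assumes P: "lead_coeff P = 1" "irreducible P" and a: "a \<in> polys_below (degree P)" "a \<noteq> 0"
    and n: "n \<ge> 2 * degree P"
  shows "(\<Sum>f\<in>monics n. chi_fin P a f * chi_inf [:\<alpha>:] f) = 0"
proof -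
  note prime = field_poly_irreducible_imp_prime[OF P(2)]
  have P0: "P \<noteq> 0" "degree P > 0" using P irreducible_degree_pos by auto
  have "\<not> P dvd a" using a by (auto simp: polys_below_iff dest: dvd_imp_degree_le)
  then have "\<not> P dvd a * pderiv P"
    using pderiv_irreducible_not_dvd[OF P(2)] prime_elem_dvd_mult_iff[OF prime] by blast
  then obtain w where w: "res P (w * (a * pderiv P)) = \<xi>" using exists_res_eq[OF P] by blast
  define c where "c f = (f * w) mod P" for f
  define t where "t f = f + P * c f" for f
  have c_t: "c (t f) = c f" for f
  proof -
    have "P dvd t f * w - f * w" by (simp add: t_def distrib_right mult.assoc del: diff_eq_add)
    then show ?thesis unfolding c_def by (simp only: mod_eq_dvd_iff)
  qed
  have "(\<Sum>f\<in>monics n. chi_fin P a f) = 0"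
  proof (rule sum_involution_eq_0[where t = t])
    fix f :: "'a poly" assume f: "f \<in> monics n"
    show "t (t f) = f" by (simp add: t_def[of "t f"] c_t) (simp add: t_def add.assoc)
    have "c f = 0 \<or> degree (c f) < degree P"
      using mod_in_polys_below[OF P0(2)] by (simp add: c_def polys_below_iff)
    then have "P * c f \<in> polys_below n"
      using n P0 by (cases "c f = 0") (auto simp: polys_below_iff degree_mult_eq)
    then show "t f \<in> monics n" unfolding t_def using f by (rule monics_add[rotated])
    have t_dvd: "P dvd t f \<longleftrightarrow> P dvd f" by (simp add: t_def dvd_add_left_iff)
    show "chi_fin P a (t f) = - chi_fin P a f"
    proof (cases "P dvd f")
      case True
      with t_dvd show ?thesis by (simp add: chi_fin_def)
    next
      case False
      define g where "g = inv_mod P f"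
      have g: "P dvd g * f - 1" unfolding g_def using inv_mod[OF P(2) False] .
      have "g * t f - 1 = (g * f - 1) + P * (g * c f)" by (simp add: t_def algebra_simps)
      moreover have "P dvd (g * f - 1) + P * (g * c f)" using g by (intro dvd_add dvd_triv_left)
      ultimately have g': "P dvd g * t f - 1" by (simp only:)
      have "res P (a * g * pderiv (t f)) = res P (a * g * pderiv f) + res P (a * g * (c f * pderiv P))"
        by (simp add: t_def pderiv_add pderiv_mult distrib_left res_add res_eq_0_of_dvd mult_ac)
      also have "res P (a * g * (c f * pderiv P)) = res P (w * (a * pderiv P))"
      proof (rule res_cong)
        have "P dvd f * w - c f" unfolding c_def by (rule dvd_minus_mod)
        then have "P dvd (w * a * pderiv P) * (g * f - 1) - (a * g * pderiv P) * (f * w - c f)"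
          using dvd_diff[OF dvd_mult[OF g] dvd_mult] by blast
        also have "\<dots> = a * g * (c f * pderiv P) - w * (a * pderiv P)"
          by (simp add: algebra_simps)
        finally show "P dvd a * g * (c f * pderiv P) - w * (a * pderiv P)" .
      qed
      finally show ?thesis
        by (simp add: chi_fin_eq[OF P(2) g] chi_fin_eq[OF P(2) g'] w \<psi>_add)
    qed
  qed
  then have "(\<Sum>f\<in>monics n. chi_fin P a f * (if even n then 1 else \<psi> \<alpha>)) = 0"
    by (simp only: sum_distrib_right[symmetric] mult_zero_left)
  then show ?thesis by (simp add: chi_inf_const)
qed

text \<open>The involution adds a fixed \<open>e\<close>, namely \<open>\<beta>\<close> T^m times
  the square of \<open>P\<close>, so that e and e' vanish modulo \<open>P\<close> and only the
  factor at infinity changes. The logarithmic derivatives of f and f + e differ by M/(f(f + e)) with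
  M = f'e + e'f. Its coefficient at n + d - 1, with d = deg e = n - (2s - 1), is (n + d)
  \<open>\<beta>\<close> = \<open>\<beta>\<close>, because n + d is odd. Multiplication by
  \<open>F\<close> moves it to the 1/T term, and \<open>\<beta>\<close> is chosen so that the result
  is \<open>\<xi>\<close>.\<close>

lemma sum_char_eq_0:
  fixes P a F :: "'a poly"
  assumes P: "lead_coeff P = 1" "irreducible P"
    and F: "degree F = 2 * s - 1" "s \<ge> 1" and n: "n \<ge> 2 * degree P + 2 * s - 1"
  shows "(\<Sum>f\<in>monics n. chi_fin P a f * chi_inf F f) = 0"
proof -
  have P0: "P \<noteq> 0" "degree P > 0" using P irreducible_degree_pos by auto
  have "F \<noteq> 0" using F by auto
  define m where "m = n - (2 * degree P + 2 * s - 1)"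
  define \<beta> where "\<beta> = \<xi> / lead_coeff F"
  have "\<xi> \<noteq> 0" using \<psi>_\<xi> \<psi>_0 by (metis one_neq_neg_one)
  then have \<beta>: "\<beta> \<noteq> 0" using \<open>F \<noteq> 0\<close> by (simp add: \<beta>_def)
  define e where "e = P\<^sup>2 * monom \<beta> m"
  define d where "d = n - (2 * s - 1)"
  have deg_e: "degree e = d"
    using P0 \<beta> n F by (simp add: e_def degree_mult_eq degree_power_eq degree_monom_eq m_def d_def monom_eq_0_iff)
  have d: "d < n" using F n P0 by (simp add: d_def)
  have "lead_coeff e = \<beta>"
    using P \<beta> by (simp add: e_def lead_coeff_mult lead_coeff_power lead_coeff_monom degree_monom_eq del: coeff_mult_degree_sum)
  then have coeff_e: "coeff e d = \<beta>" by (simp add: deg_e)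
  have "P dvd e" by (simp add: e_def power2_eq_square)
  have "pderiv e = P\<^sup>2 * pderiv (monom \<beta> m)" by (simp add: e_def pderiv_mult)
  then have "P dvd pderiv e" by (simp add: power2_eq_square)
  show ?thesis
  proof (rule sum_involution_eq_0[where t = "\<lambda>f. f + e"])
    fix f :: "'a poly" assume f: "f \<in> monics n"
    show "f + e + e = f" by (simp add: add.assoc)
    have "e \<in> polys_below n" using d deg_e by (simp add: polys_below_iff)
    then show fe: "f + e \<in> monics n" using f by (rule monics_add[rotated])
    have f': "lead_coeff f = 1" "degree f = n" and fe': "lead_coeff (f + e) = 1" "degree (f + e) = n"
      using f fe by (auto simp: monics_def)
    have "chi_fin P a (f + e) = chi_fin P a f"
    proof (cases "P dvd f")
      case True
      then show ?thesis using \<open>P dvd e\<close> by (simp add: chi_fin_def)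
    next
      case False
      define g where "g = inv_mod P f"
      have g: "P dvd g * f - 1" unfolding g_def using inv_mod[OF P(2) False] .
      have "g * (f + e) - 1 = (g * f - 1) + g * e" by (simp add: algebra_simps)
      moreover have "P dvd (g * f - 1) + g * e" using g \<open>P dvd e\<close> by (intro dvd_add dvd_mult)
      ultimately have g': "P dvd g * (f + e) - 1" by (simp only:)
      show ?thesis
        using \<open>P dvd pderiv e\<close>
        by (simp add: chi_fin_eq[OF P(2) g] chi_fin_eq[OF P(2) g'] pderiv_add distrib_left res_add res_eq_0_of_dvd)
    qed
    moreover have "chi_inf F (f + e) = - chi_inf F f"
    proof -
      define M where "M = pderiv f * e + pderiv e * f"
      have n0: "n > 0" using d by simp
      have d0: "d > 0" using n F P0 by (simp add: d_def)
      have df: "degree (pderiv f) \<le> n - 1" using degree_pderiv_less[of f] f' n0 by simp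
      have de: "degree (pderiv e) \<le> d - 1"
        by (rule degree_le) (auto simp: coeff_pderiv coeff_eq_0 deg_e)
      have "degree (pderiv f * e) \<le> n + d - 1"
        using degree_mult_le[of "pderiv f" e] df n0 unfolding deg_e by linarith
      moreover have "degree (pderiv e * f) \<le> n + d - 1"
        using degree_mult_le[of "pderiv e" f] de d0 unfolding f' by linarith
      ultimately have dM: "degree M \<le> n + d - 1" unfolding M_def by (rule degree_add_le)
      have "res f (F * pderiv f) + res (f + e) (F * pderiv (f + e))
          = res (f * (f + e)) (F * pderiv f * (f + e)) + res ((f + e) * f) (F * pderiv (f + e) * f)"
        by (simp only: res_mult_cancel[OF f'(1) fe'(1)] res_mult_cancel[OF fe'(1) f'(1)])
      also have "\<dots> = res (f * (f + e)) (F * M)"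
        by (simp add: M_def pderiv_add algebra_simps flip: res_add)
      also have "\<dots> = coeff (F * M) (2 * n - 1)"
      proof -
        have "degree (F * M) < 2 * n"
          using dM degree_mult_le[of F M] F n d unfolding d_def by linarith
        moreover have "degree (f * (f + e)) = 2 * n"
          using monics_mult[OF f fe] by (simp add: monics_def)
        ultimately show ?thesis by (simp add: res_degree_less)
      qed
      also have "\<dots> = lead_coeff F * \<beta>"
      proof -
        have "coeff (pderiv f * e) ((n - 1) + d) = coeff (pderiv f) (n - 1) * coeff e d"
          using df deg_e by (intro coeff_mult_top) auto
        then have 1: "coeff (pderiv f * e) (n + d - 1) = of_nat n * \<beta>"
          using n0 coeff_pderiv_monic[OF f] by (simp add: coeff_e)
        have "coeff (pderiv e * f) ((d - 1) + n) = coeff (pderiv e) (d - 1) * coeff f n"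
          using de f' by (intro coeff_mult_top) auto
        then have 2: "coeff (pderiv e * f) (n + d - 1) = of_nat d * \<beta>"
          using d0 f by (simp add: coeff_pderiv coeff_e monics_iff add.commute)
        have "odd (n + d)" using n F P0 by (simp add: d_def)
        moreover have "coeff M (n + d - 1) = of_nat (n + d) * \<beta>"
          unfolding M_def coeff_add 1 2 by (simp add: distrib_right)
        ultimately have "coeff M (n + d - 1) = \<beta>" unfolding of_nat_parity by simp
        moreover have "coeff (F * M) ((2 * s - 1) + (n + d - 1)) = coeff F (2 * s - 1) * coeff M (n + d - 1)"
          using F dM by (intro coeff_mult_top) auto
        moreover have "(2 * s - 1) + (n + d - 1) = 2 * n - 1"
          using n F P0 by (simp add: d_def)
        ultimately show ?thesis using F(1) by simp
      qed
      also have "\<dots> = \<xi>" using \<open>F \<noteq> 0\<close> by (simp add: \<beta>_def)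
      finally have "res (f + e) (F * pderiv (f + e)) = res f (F * pderiv f) + \<xi>"
        by (metis add_self_left(1))
      then show ?thesis by (simp add: chi_inf_def \<psi>_add)
    qed
    ultimately show "chi_fin P a (f + e) * chi_inf F (f + e) = - (chi_fin P a f * chi_inf F f)" by simp
  qed
qed

end

subsection \<open>Averages over the families with a fixed prime\<close>

lemma L_fun_1_eq:
  fixes u :: "'a::finite_field poly fract"
  assumes "\<And>n. n \<ge> N \<Longrightarrow> (\<Sum>f\<in>monics n. of_int (hasse_char u f)) = (0 :: real)"
  shows "L_fun 1 u = of_real (\<Sum>n<N. (\<Sum>f\<in>monics n. of_int (hasse_char u f)) / real CARD('a) ^ n)"
proof -
  let ?S = "\<lambda>n. (\<Sum>f\<in>monics n. of_int (hasse_char u f)) :: real"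
  have summand: "(\<Sum>f | lead_coeff f = 1 \<and> degree f = n. of_int (hasse_char u f) * complex_of_real (poly_abs f) powr (- 1))
      = of_real (?S n / real CARD('a) ^ n)" for n
  proof -
    have "(\<Sum>f | lead_coeff f = 1 \<and> degree f = n. of_int (hasse_char u f) * complex_of_real (poly_abs f) powr (- 1))
        = (\<Sum>f\<in>monics n. of_int (hasse_char u f) * complex_of_real (real CARD('a) ^ n) powr (- 1))"
      unfolding monics_def by (intro sum.cong refl) (auto simp: poly_abs_def)
    also have "complex_of_real (real CARD('a) ^ n) powr (- 1) = of_real (1 / real CARD('a) ^ n)"
      by (simp add: powr_minus divide_inverse del: of_real_power)
    finally show ?thesis by (simp add: sum_divide_distrib flip: sum_distrib_right)
  qed
  have "(\<Sum>n. complex_of_real (?S n / real CARD('a) ^ n)) = (\<Sum>n<N. complex_of_real (?S n / real CARD('a) ^ n))"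
    by (rule suminf_finite) (use assms in auto)
  then show ?thesis unfolding L_fun_def summand by simp
qed

lemma sum_lessThan_double: "(\<Sum>n<2 * N. g n) = (\<Sum>m<N. g (2 * m) + g (2 * m + 1))"
  for g :: "nat \<Rightarrow> 'b::comm_monoid_add"
  by (induction N) (simp_all add: add.assoc)

section \<open>The sets \<open>G_set\<close>: symmetries and size\<close>

lemma coeff_odd_sum_monom:
  fixes c :: "nat \<Rightarrow> 'a::comm_monoid_add"
  assumes "j \<ge> 1"
  shows "coeff (\<Sum>i=1..s. monom (c i) (2 * i - 1)) (2 * j - 1) = (if j \<le> s then c j else 0)"
proof -
  have "coeff (\<Sum>i=1..s. monom (c i) (2 * i - 1)) (2 * j - 1) = (\<Sum>i=1..s. if i = j then c j else 0)"
    unfolding coeff_sum using assms by (intro sum.cong refl) auto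
  then show ?thesis using assms by simp
qed

lemma G_set_degree:
  assumes "F \<in> G_set \<xi> s" "s \<ge> 1" shows "degree F = 2 * s - 1"
proof -
  obtain \<alpha> c where F: "F = [:\<alpha>:] + (\<Sum>i=1..s. monom (c i) (2 * i - 1))" and c: "c s \<noteq> 0"
    using assms(1) by (auto simp: G_set_def)
  have "coeff [:\<alpha>:] (2 * s - 1) = 0" using assms(2) by (auto simp: coeff_pCons split: nat.splits)
  then have "coeff F (2 * s - 1) = c s" unfolding F coeff_add using assms(2) coeff_odd_sum_monom[of s c s] by simp
  moreover have "degree F \<le> 2 * s - 1"
    unfolding F by (intro degree_add_le degree_sum_le order_trans[OF degree_monom_le]) auto
  ultimately show ?thesis using c le_degree[of F "2 * s - 1"] by simp
qed

lemma G_set_add_const: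
  fixes F :: "'a::field poly"
  assumes "F \<in> G_set \<xi> s" "\<xi> + \<xi> = 0" shows "F + [:\<xi>:] \<in> G_set \<xi> s"
proof -
  obtain \<alpha> c where F: "F = [:\<alpha>:] + (\<Sum>i=1..s. monom (c i) (2 * i - 1))" and c: "c s \<noteq> 0" "\<alpha> \<in> {0, \<xi>}"
    using assms(1) by (auto simp: G_set_def)
  have "F + [:\<xi>:] = [:\<alpha> + \<xi>:] + (\<Sum>i=1..s. monom (c i) (2 * i - 1))" by (simp add: F add_ac)
  moreover have "\<alpha> + \<xi> \<in> {0, \<xi>}" using c assms(2) by auto
  ultimately show ?thesis using c(1) unfolding G_set_def by blast
qed

text \<open>The strict bound j < s leaves the required nonzero top coefficient alone. With
  \<open>G_set_add_const\<close> these are the translations used to cancel averages over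
  \<open>G_set\<close>.\<close>

lemma G_set_add_monom:
  fixes F :: "'a::field poly"
  assumes "F \<in> G_set \<xi> s" "j \<ge> 1" "j < s" shows "F + monom \<beta> (2 * j - 1) \<in> G_set \<xi> s"
proof -
  obtain \<alpha> c where F: "F = [:\<alpha>:] + (\<Sum>i=1..s. monom (c i) (2 * i - 1))" and c: "c s \<noteq> 0" "\<alpha> \<in> {0, \<xi>}"
    using assms(1) by (auto simp: G_set_def)
  define c' where "c' = c(j := c j + \<beta>)"
  have "(\<Sum>i=1..s. monom (c' i) (2 * i - 1)) = (\<Sum>i=1..s. monom (c i) (2 * i - 1) + (if i = j then monom \<beta> (2 * i - 1) else 0))"
    by (intro sum.cong refl) (auto simp: c'_def add_monom)
  also have "\<dots> = (\<Sum>i=1..s. monom (c i) (2 * i - 1)) + monom \<beta> (2 * j - 1)"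
    using assms by (simp add: sum.distrib)
  finally have "F + monom \<beta> (2 * j - 1) = [:\<alpha>:] + (\<Sum>i=1..s. monom (c' i) (2 * i - 1))"
    by (simp add: F add_ac)
  moreover have "c' s \<noteq> 0" using c assms by (simp add: c'_def)
  ultimately show ?thesis using c(2) unfolding G_set_def by blast
qed

text \<open>In \<open>G_set\<close> the function \<open>c\<close> matters only on {1..s}. Taking
  extensional functions makes the parametrization injective, since the odd coefficients recover
  \<open>c\<close> and the constant one recovers \<open>\<alpha>\<close>.\<close>

lemma finite_card_G_set:
  assumes "\<xi> \<noteq> 0" "s \<ge> 1"
  shows "finite (G_set \<xi> s :: 'a::finite_field poly set) \<and>
    card (G_set \<xi> s) = 2 * ((CARD('a) - 1) * CARD('a) ^ (s - 1))"
proof -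
  define C where "C = (\<Pi>\<^sub>E i\<in>{1..s}. if i = s then UNIV - {0} else UNIV :: 'a set)"
  define \<Phi> where "\<Phi> = (\<lambda>(\<alpha> :: 'a, c). [:\<alpha>:] + (\<Sum>i=1..s. monom (c i) (2 * i - 1)))"
  have fin: "finite ({0, \<xi>} \<times> C)" unfolding C_def by (intro finite_cartesian_product finite_PiE) auto
  have "G_set \<xi> s = \<Phi> ` ({0, \<xi>} \<times> C)"
  proof (intro set_eqI iffI)
    fix F assume "F \<in> G_set \<xi> s"
    then obtain \<alpha> c where F: "F = [:\<alpha>:] + (\<Sum>i=1..s. monom (c i) (2 * i - 1))" and c: "c s \<noteq> 0" "\<alpha> \<in> {0, \<xi>}"
      by (auto simp: G_set_def)
    define c' where "c' = restrict c {1..s}"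
    have "c' \<in> C" using c by (auto simp: C_def c'_def)
    moreover have "(\<Sum>i=1..s. monom (c i) (2 * i - 1)) = (\<Sum>i=1..s. monom (c' i) (2 * i - 1))"
      by (intro sum.cong refl) (simp add: c'_def)
    then have "F = \<Phi> (\<alpha>, c')" unfolding F \<Phi>_def by simp
    ultimately show "F \<in> \<Phi> ` ({0, \<xi>} \<times> C)" using c by blast
  next
    fix F assume "F \<in> \<Phi> ` ({0, \<xi>} \<times> C)"
    then obtain \<alpha> c where c: "\<alpha> \<in> {0, \<xi>}" "c \<in> C" "F = \<Phi> (\<alpha>, c)" by auto
    have "c s \<noteq> 0" using PiE_mem[OF c(2)[unfolded C_def], of s] assms(2) by simp
    with c show "F \<in> G_set \<xi> s" unfolding G_set_def \<Phi>_def by auto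
  qed
  moreover have "inj_on \<Phi> ({0, \<xi>} \<times> C)"
  proof (rule inj_onI, clarify)
    fix \<alpha> c \<alpha>' c' assume c: "c \<in> C" "c' \<in> C" and eq: "\<Phi> (\<alpha>, c) = \<Phi> (\<alpha>', c')"
    have "coeff (\<Sum>i=1..s. monom (c i) (2 * i - 1)) 0 = 0" for c :: "nat \<Rightarrow> 'a"
      unfolding coeff_sum by (intro sum.neutral) auto
    with arg_cong[OF eq, of "\<lambda>p. coeff p 0"] have "\<alpha> = \<alpha>'" by (simp add: \<Phi>_def)
    moreover have "c = c'"
    proof (rule PiE_ext)
      show "c \<in> (\<Pi>\<^sub>E i\<in>{1..s}. if i = s then UNIV - {0} else UNIV)"
        "c' \<in> (\<Pi>\<^sub>E i\<in>{1..s}. if i = s then UNIV - {0} else UNIV)" using c by (auto simp: C_def)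
      fix j assume j: "j \<in> {1..s}"
      have "(\<Sum>i=1..s. monom (c i) (2 * i - 1)) = (\<Sum>i=1..s. monom (c' i) (2 * i - 1))"
        using eq \<open>\<alpha> = \<alpha>'\<close> by (simp add: \<Phi>_def)
      from arg_cong[OF this, of "\<lambda>p. coeff p (2 * j - 1)"] j show "c j = c' j"
        by (simp only: coeff_odd_sum_monom[of j] atLeastAtMost_iff) simp
    qed
    ultimately show "\<alpha> = \<alpha>' \<and> c = c'" by simp
  qed
  moreover have "card C = (CARD('a) - 1) * CARD('a) ^ (s - 1)"
  proof -
    have "card C = (\<Prod>i=1..s. card (if i = s then UNIV - {0} else UNIV :: 'a set))"
      unfolding C_def by (rule card_PiE) simp
    also have "\<dots> = card (UNIV - {0 :: 'a}) * (\<Prod>i\<in>{1..s} - {s}. card (if i = s then UNIV - {0} else UNIV :: 'a set))"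
      using assms(2) by (subst prod.remove[of _ s]) auto
    also have "(\<Prod>i\<in>{1..s} - {s}. card (if i = s then UNIV - {0} else UNIV :: 'a set)) = (\<Prod>i\<in>{1..s} - {s}. CARD('a))"
      by (intro prod.cong refl) auto
    finally show ?thesis using assms(2) by (simp add: card_Diff_singleton)
  qed
  ultimately show ?thesis using fin assms(1)
    by (simp add: card_image card_cartesian_product)
qed

section \<open>Squares prime to \<open>P\<close> and their Dirichlet series\<close>

context even_field
begin

lemma q_ge_2: "q \<ge> 2"
  using card_finite_field_ge_2[where 'a = 'a] unfolding real_card[symmetric] by simp

lemma of_nat_card [simp]: "real CARD('a) = q"
  by (rule real_card)

lemma \<xi>_nonzero: "\<xi> \<noteq> 0"
  using \<psi>_\<xi> \<psi>_0 by (metis one_neq_neg_one)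

text \<open>Since f' is a square B^2, P | f' gives P | B, so \<open>P\<close> divides f' twice. This
  doubling lets the diagonal argument reach the whole range n < 2 deg P.\<close>

lemma degree_pderiv_ge:
  fixes P f :: "'a poly"
  assumes "irreducible P" "P dvd pderiv f" "pderiv f \<noteq> 0"
  shows "2 * degree P \<le> degree (pderiv f)"
proof -
  obtain A B where "f = A\<^sup>2 + [:0, 1:] * B\<^sup>2" using even_odd_decomp by blast
  then have B: "pderiv f = B\<^sup>2" using pderiv_decomp by metis
  then have "P dvd B" using assms(1,2) prime_elem_dvd_power field_poly_irreducible_imp_prime by metis
  moreover have "B \<noteq> 0" using B assms(3) by auto
  ultimately show ?thesis unfolding B by (simp add: degree_power_eq dvd_imp_degree_le)
qed

lemma even_degree_pderiv: "even (degree (pderiv (f :: 'a poly)))"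
proof -
  obtain A B where "f = A\<^sup>2 + [:0, 1:] * B\<^sup>2" using even_odd_decomp by blast
  then have "pderiv f = B\<^sup>2" using pderiv_decomp by metis
  then show ?thesis by (cases "B = 0") (simp_all add: degree_power_eq)
qed

lemma monics_pderiv_eq_0_iff:
  "f \<in> monics n \<and> pderiv f = 0 \<longleftrightarrow> (\<exists>m l. n = 2 * m \<and> l \<in> monics m \<and> f = (l :: 'a poly)\<^sup>2)"
proof
  assume f: "f \<in> monics n \<and> pderiv f = 0"
  obtain A B where AB: "f = A\<^sup>2 + [:0, 1:] * B\<^sup>2" using even_odd_decomp by blast
  with f have "B\<^sup>2 = 0" using pderiv_decomp by metis
  with AB have fA: "f = A\<^sup>2" by simp
  have A0: "A \<noteq> 0" using f fA by (auto simp: monics_def)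
  have "(lead_coeff A)\<^sup>2 = 1" using f fA by (simp add: monics_def lead_coeff_power)
  then have "(lead_coeff A + 1)\<^sup>2 = 0" by (simp add: square_add)
  then have "lead_coeff A = 1" by (metis add_eq_0_iff uminus_eq(1) zero_eq_power2 add.commute)
  then have "A \<in> monics (degree A)" by (simp add: monics_def)
  moreover have "n = 2 * degree A" using f fA A0 by (auto simp: monics_def degree_power_eq)
  ultimately show "\<exists>m l. n = 2 * m \<and> l \<in> monics m \<and> f = l\<^sup>2" using fA by blast
next
  assume "\<exists>m l. n = 2 * m \<and> l \<in> monics m \<and> f = l\<^sup>2"
  then show "f \<in> monics n \<and> pderiv f = 0" by (auto intro: monics_power)
qed

definition sq_count :: "'a poly \<Rightarrow> nat \<Rightarrow> nat" where
  "sq_count P n = card {f \<in> monics n. pderiv f = 0 \<and> \<not> P dvd f}"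

lemma sq_count_odd: "sq_count P (2 * m + 1) = 0"
proof -
  have "{f \<in> monics (2 * m + 1). pderiv f = 0 \<and> \<not> P dvd f} = {}"
  proof (rule equals0I)
    fix f assume "f \<in> {f \<in> monics (2 * m + 1). pderiv f = 0 \<and> \<not> P dvd f}"
    then obtain k where "2 * m + 1 = 2 * k" using monics_pderiv_eq_0_iff[of f "2 * m + 1"] by auto
    then show False by presburger
  qed
  then show ?thesis by (simp add: sq_count_def)
qed

lemma sq_count_even:
  assumes "irreducible P" shows "sq_count P (2 * m) = card {l \<in> monics m. \<not> P dvd l}"
proof -
  have P: "P dvd l\<^sup>2 \<longleftrightarrow> P dvd l" for l
  proof
    assume "P dvd l\<^sup>2"
    then show "P dvd l" by (rule prime_elem_dvd_power[OF field_poly_irreducible_imp_prime[OF assms]])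
  qed (simp add: power2_eq_square)
  have "{f \<in> monics (2 * m). pderiv f = 0 \<and> \<not> P dvd f} = (\<lambda>l. l\<^sup>2) ` {l \<in> monics m. \<not> P dvd l}"
  proof (intro set_eqI iffI)
    fix f assume "f \<in> {f \<in> monics (2 * m). pderiv f = 0 \<and> \<not> P dvd f}"
    then show "f \<in> (\<lambda>l. l\<^sup>2) ` {l \<in> monics m. \<not> P dvd l}"
      using monics_pderiv_eq_0_iff[of f "2 * m"] P by auto
  next
    fix f assume "f \<in> (\<lambda>l. l\<^sup>2) ` {l \<in> monics m. \<not> P dvd l}"
    then show "f \<in> {f \<in> monics (2 * m). pderiv f = 0 \<and> \<not> P dvd f}"
      using monics_pderiv_eq_0_iff[of f "2 * m"] P by auto
  qed
  moreover have "inj_on (\<lambda>l. l\<^sup>2) {l \<in> monics m. \<not> P dvd l}"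
  proof (rule inj_onI)
    fix x y :: "'a poly" assume "x\<^sup>2 = y\<^sup>2"
    then have "(x - y)\<^sup>2 = 0" by (simp add: square_add)
    then show "x = y" by (simp del: diff_eq_add)
  qed
  ultimately show ?thesis by (simp add: sq_count_def card_image)
qed

lemma sq_count_even_le: "irreducible P \<Longrightarrow> real (sq_count P (2 * m)) \<le> q ^ m"
proof -
  assume "irreducible P"
  then have "sq_count P (2 * m) \<le> card (monics m :: 'a poly set)"
    unfolding sq_count_even[OF \<open>irreducible P\<close>] by (intro card_mono) auto
  from of_nat_mono[OF this, where 'a = real] show ?thesis by (simp add: card_monics)
qed

lemma sq_count_even_eq:
  assumes "irreducible P" "m < degree P" shows "real (sq_count P (2 * m)) = q ^ m"
proof -
  have "{l \<in> monics m. \<not> P dvd l} = monics m"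
    using assms(2) monics_nonzero by (fastforce simp: monics_def dest: dvd_imp_degree_le)
  then show ?thesis using sq_count_even[OF assms(1), of m] by (simp add: card_monics)
qed

text \<open>The real number zeta_A(2): the sum of |l|^(-2) over monic l, that is, of 1/|f| over
  monic squares f.\<close>

definition Z :: real where "Z = 1 / (1 - 1 / q)"

lemma Z_bounds: "1 \<le> Z" "Z \<le> 2"
  using q_ge_2 by (auto simp: Z_def field_simps)

lemma sum_inverse_powers: "(\<Sum>m<k. (1 / q) ^ m) = Z * (1 - (1 / q) ^ k)"
  using q_ge_2 by (subst sum_gp_strict) (simp_all add: Z_def)

text \<open>Squares of l with deg l < deg P are automatically prime to \<open>P\<close>, and N >= 2
  deg P includes all of them. Thus \<open>D\<close> lies between a partial geometric sum and the
  full one, and the gap is Z q^(-deg P).\<close>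

lemma sq_count_series:
  fixes P :: "'a poly"
  assumes P: "irreducible P" and N: "N \<ge> 2 * degree P"
  defines "D \<equiv> (\<Sum>n<N. real (sq_count P n) / q ^ n)"
  shows "D \<le> Z" "0 \<le> D" "\<bar>D - Z\<bar> \<le> 2 / q ^ degree P"
proof -
  have q0: "q > 0" using q_ge_2 by simp
  have pow: "q ^ m / q ^ (2 * m) = (1 / q) ^ m" for m
    using q0 by (simp add: mult_2 power_add power_divide)
  have nonneg: "0 \<le> real (sq_count P n) / q ^ n" for n using q0 by simp
  have double: "(\<Sum>n<2 * k. real (sq_count P n) / q ^ n) = (\<Sum>m<k. real (sq_count P (2 * m)) / q ^ (2 * m))" for k
    by (simp only: sum_lessThan_double sq_count_odd) simp
  \<comment> \<open>The range is enlarged to the even length 2N so that degrees can be paired; odd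
    degrees contain no squares.\<close>
  have "D \<le> (\<Sum>n<2 * N. real (sq_count P n) / q ^ n)"
    unfolding D_def by (rule sum_mono2) (use nonneg in auto)
  also have "\<dots> \<le> (\<Sum>m<N. (1 / q) ^ m)"
    unfolding double
  proof (rule sum_mono)
    fix m
    have "real (sq_count P (2 * m)) / q ^ (2 * m) \<le> q ^ m / q ^ (2 * m)"
      using sq_count_even_le[OF P] q0 by (intro divide_right_mono) auto
    also have "\<dots> = (1 / q) ^ m" by (rule pow)
    finally show "real (sq_count P (2 * m)) / q ^ (2 * m) \<le> (1 / q) ^ m" .
  qed
  also have "\<dots> \<le> Z" unfolding sum_inverse_powers using Z_bounds q0 by (simp add: mult_le_cancel_left1)
  finally show "D \<le> Z" .
  show "0 \<le> D" unfolding D_def by (intro sum_nonneg nonneg)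
  have "Z * (1 - (1 / q) ^ degree P) = (\<Sum>m<degree P. (1 / q) ^ m)" by (simp add: sum_inverse_powers)
  also have "\<dots> = (\<Sum>m<degree P. real (sq_count P (2 * m)) / q ^ (2 * m))"
    by (intro sum.cong refl) (simp add: sq_count_even_eq[OF P] pow)
  also have "\<dots> \<le> D" unfolding double[symmetric] D_def
    by (rule sum_mono2) (use nonneg N in auto)
  finally have "Z - D \<le> Z * (1 / q) ^ degree P" by (simp add: algebra_simps)
  also have "\<dots> \<le> 2 * (1 / q) ^ degree P" using Z_bounds q0 by (intro mult_right_mono) auto
  finally show "\<bar>D - Z\<bar> \<le> 2 / q ^ degree P" using \<open>D \<le> Z\<close> by (simp add: power_divide)
qed

text \<open>The cutoff is a parameter because the coefficients vanish from different degrees on: 2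
  deg P for constant \<open>F\<close>, and 2 deg P + 2s - 1 for \<open>F\<close> in
  \<open>G_set \<xi> s\<close>.\<close>

definition L_val :: "'a poly \<Rightarrow> 'a poly \<Rightarrow> 'a poly \<Rightarrow> nat \<Rightarrow> real" where
  "L_val P a F N = (\<Sum>n<N. (\<Sum>f\<in>monics n. chi_fin P a f * chi_inf F f) / q ^ n)"

lemma L_fun_eq_L_val:
  fixes P a F :: "'a poly"
  assumes P: "lead_coeff P = 1" "irreducible P" and a: "a \<in> polys_below (degree P)" "a \<noteq> 0"
    and vanish: "\<And>n. n \<ge> N \<Longrightarrow> (\<Sum>f\<in>monics n. chi_fin P a f * chi_inf F f) = 0"
  shows "L_fun 1 (Fract a P + to_fract F) = of_real (L_val P a F N)"
proof -
  have eq: "(\<Sum>f\<in>monics n. of_int (hasse_char (Fract a P + to_fract F) f))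
      = (\<Sum>f\<in>monics n. chi_fin P a f * chi_inf F f)" for n
    by (intro sum.cong refl hasse_char_eq[OF P a]) (unfold monics_def, blast)
  show ?thesis
    using L_fun_1_eq[of N "Fract a P + to_fract F"] vanish by (simp only: eq L_val_def of_nat_card)
qed

text \<open>One factor of the character depends on \<open>a\<close>, the other on \<open>F\<close>,
  so for each \<open>f\<close> the double sum becomes a product of two sums.\<close>

lemma sum_L_val_swap:
  "(\<Sum>F\<in>S. \<Sum>a\<in>V. L_val P a F N)
   = (\<Sum>n<N. (\<Sum>f\<in>monics n. (\<Sum>F\<in>S. chi_inf F f) * (\<Sum>a\<in>V. chi_fin P a f)) / q ^ n)"
proof -
  have "(\<Sum>F\<in>S. \<Sum>a\<in>V. L_val P a F N)
      = (\<Sum>F\<in>S. \<Sum>n<N. \<Sum>a\<in>V. (\<Sum>f\<in>monics n. chi_fin P a f * chi_inf F f) / q ^ n)"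
    unfolding L_val_def by (intro sum.cong refl sum.swap)
  also have "\<dots> = (\<Sum>n<N. \<Sum>F\<in>S. \<Sum>a\<in>V. (\<Sum>f\<in>monics n. chi_fin P a f * chi_inf F f) / q ^ n)"
    by (rule sum.swap)
  also have "\<dots> = (\<Sum>n<N. (\<Sum>f\<in>monics n. (\<Sum>F\<in>S. chi_inf F f) * (\<Sum>a\<in>V. chi_fin P a f)) / q ^ n)"
  proof (intro sum.cong refl)
    fix n
    have "(\<Sum>F\<in>S. \<Sum>a\<in>V. \<Sum>f\<in>monics n. chi_fin P a f * chi_inf F f)
        = (\<Sum>F\<in>S. \<Sum>f\<in>monics n. \<Sum>a\<in>V. chi_fin P a f * chi_inf F f)"
      by (intro sum.cong refl sum.swap)
    also have "\<dots> = (\<Sum>f\<in>monics n. \<Sum>F\<in>S. \<Sum>a\<in>V. chi_fin P a f * chi_inf F f)"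
      by (rule sum.swap)
    also have "\<dots> = (\<Sum>f\<in>monics n. (\<Sum>F\<in>S. chi_inf F f) * (\<Sum>a\<in>V. chi_fin P a f))"
      by (simp add: sum_product mult.commute)
    finally show "(\<Sum>F\<in>S. \<Sum>a\<in>V. (\<Sum>f\<in>monics n. chi_fin P a f * chi_inf F f) / q ^ n)
        = (\<Sum>f\<in>monics n. (\<Sum>F\<in>S. chi_inf F f) * (\<Sum>a\<in>V. chi_fin P a f)) / q ^ n"
      by (simp flip: sum_divide_distrib)
  qed
  finally show ?thesis .
qed

text \<open>The polynomials with derivative zero are the squares; they give the main term.\<close>

lemma sum_L_val_approx:
  fixes P :: "'a poly"
  assumes P: "lead_coeff P = 1" "irreducible P" and N: "N \<ge> 2 * degree P"
    and E: "\<And>n. n < N \<Longrightarrow> (\<Sum>f | f \<in> monics n \<and> pderiv f \<noteq> 0.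
        \<bar>(\<Sum>F\<in>S. chi_inf F f) * (\<Sum>a\<in>polys_below (degree P) - {0}. chi_fin P a f)\<bar>) \<le> E * q ^ n"
  shows "\<bar>(\<Sum>F\<in>S. \<Sum>a\<in>polys_below (degree P) - {0}. L_val P a F N) - real (card S) * q ^ degree P * Z\<bar>
       \<le> real N * E + 4 * real (card S)"
proof -
  have q0: "q > 0" using q_ge_2 by simp
  let ?V = "polys_below (degree P) - {0 :: 'a poly}"
  let ?Y = "\<lambda>f. \<Sum>F\<in>S. chi_inf F f"
  let ?X = "\<lambda>f. \<Sum>a\<in>?V. chi_fin P a f"
  let ?r = "degree P"
  define D where "D = (\<Sum>n<N. real (sq_count P n) / q ^ n)"
  define c where "c = real (card S)"
  have inner: "\<bar>(\<Sum>f\<in>monics n. ?Y f * ?X f) / q ^ n - c * (q ^ ?r - 1) * (real (sq_count P n) / q ^ n)\<bar> \<le> E"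
    if "n < N" for n
  proof -
    have fin: "finite (monics n :: 'a poly set)" by simp
    have "(\<Sum>f\<in>monics n. ?Y f * ?X f)
        = (\<Sum>f\<in>{f \<in> monics n. pderiv f = 0} \<union> {f. f \<in> monics n \<and> pderiv f \<noteq> 0}. ?Y f * ?X f)"
      by (intro sum.cong) auto
    also have "\<dots> = (\<Sum>f\<in>{f \<in> monics n. pderiv f = 0}. ?Y f * ?X f)
        + (\<Sum>f | f \<in> monics n \<and> pderiv f \<noteq> 0. ?Y f * ?X f)"
      by (rule sum.union_disjoint) auto
    \<comment> \<open>When f' = 0 every \<open>chi_inf F f\<close> is 1, so the sum over
      \<open>S\<close> is its cardinality.\<close>
    also have "(\<Sum>f\<in>{f \<in> monics n. pderiv f = 0}. ?Y f * ?X f)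
        = (\<Sum>f\<in>{f \<in> monics n. pderiv f = 0}. if \<not> P dvd f then c * (q ^ ?r - 1) else 0)"
      by (intro sum.cong refl) (auto simp: sum_chi_fin[OF P] chi_inf_def res_eq_0_of_dvd c_def)
    also have "\<dots> = c * (q ^ ?r - 1) * sq_count P n"
      by (subst sum.inter_filter[symmetric]) (simp_all add: sq_count_def conj_assoc)
    finally have "\<bar>(\<Sum>f\<in>monics n. ?Y f * ?X f) - c * (q ^ ?r - 1) * sq_count P n\<bar>
        = \<bar>\<Sum>f | f \<in> monics n \<and> pderiv f \<noteq> 0. ?Y f * ?X f\<bar>" by simp
    also have "\<dots> \<le> E * q ^ n" using E[OF that] by (rule order_trans[OF sum_abs])
    finally show ?thesis using q0 by (simp add: diff_divide_distrib[symmetric] pos_divide_le_eq)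
  qed
  have "\<bar>(\<Sum>F\<in>S. \<Sum>a\<in>?V. L_val P a F N) - c * (q ^ ?r - 1) * D\<bar>
      = \<bar>\<Sum>n<N. (\<Sum>f\<in>monics n. ?Y f * ?X f) / q ^ n - c * (q ^ ?r - 1) * (real (sq_count P n) / q ^ n)\<bar>"
    unfolding sum_L_val_swap D_def sum_distrib_left sum_subtractf ..
  also have "\<dots> \<le> (\<Sum>n<N. E)"
    using inner by (intro order_trans[OF sum_abs] sum_mono) auto
  finally have 1: "\<bar>(\<Sum>F\<in>S. \<Sum>a\<in>?V. L_val P a F N) - c * (q ^ ?r - 1) * D\<bar> \<le> real N * E" by simp
  \<comment> \<open>This is the cost of replacing (q^r - 1) D by q^r Z; |D - Z| <= 2/q^r and |D| <=
    2 produce the constant 4.\<close>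
  have "\<bar>q ^ ?r * (D - Z) - D\<bar> \<le> q ^ ?r * \<bar>D - Z\<bar> + \<bar>D\<bar>"
    using abs_triangle_ineq4[of "q ^ ?r * (D - Z)" D] using q0 by (simp add: abs_mult)
  also have "q ^ ?r * \<bar>D - Z\<bar> \<le> q ^ ?r * (2 / q ^ ?r)"
    using sq_count_series(3)[OF P(2) N] q0 unfolding D_def by (intro mult_left_mono) auto
  also have "q ^ ?r * (2 / q ^ ?r) = 2" using q0 by simp
  also have "\<bar>D\<bar> \<le> 2" using sq_count_series(1,2)[OF P(2) N] Z_bounds unfolding D_def by simp
  finally have "\<bar>c * (q ^ ?r * (D - Z) - D)\<bar> \<le> c * 4" unfolding abs_mult by (simp add: c_def mult_left_mono)
  moreover have "c * (q ^ ?r * (D - Z) - D) = c * (q ^ ?r - 1) * D - c * q ^ ?r * Z"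
    by (simp add: algebra_simps)
  ultimately have "\<bar>c * (q ^ ?r - 1) * D - c * q ^ ?r * Z\<bar> \<le> 4 * c" by simp
  with 1 show ?thesis unfolding c_def by linarith
qed

lemma sum_chi_fin_abs_le:
  fixes P f :: "'a poly"
  assumes P: "lead_coeff P = 1" "irreducible P" and f: "pderiv f \<noteq> 0" "degree (pderiv f) < 2 * degree P"
  shows "\<bar>\<Sum>a\<in>polys_below (degree P) - {0}. chi_fin P a f\<bar> \<le> 1"
  using degree_pderiv_ge[OF P(2) _ f(1)] f(2) by (auto simp: sum_chi_fin[OF P])

text \<open>In each degree n < 2 deg P at most q^n nonsquares contribute at most 1 each, and
  division by q^n leaves an error 1 per degree. The families without and with \<open>\<xi>\<close>
  are the cases \<open>\<alpha>\<close> = 0 and \<open>\<alpha>\<close> =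
  \<open>\<xi>\<close>.\<close>

lemma sum_L_val_const:
  fixes P :: "'a poly"
  assumes P: "lead_coeff P = 1" "irreducible P"
  shows "\<bar>(\<Sum>a\<in>polys_below (degree P) - {0}. L_val P a [:\<alpha>:] (2 * degree P)) - q ^ degree P * Z\<bar>
       \<le> 2 * degree P + 4"
proof -
  have "\<bar>(\<Sum>F\<in>{[:\<alpha>:]}. \<Sum>a\<in>polys_below (degree P) - {0}. L_val P a F (2 * degree P)) - real (card {[:\<alpha>:]}) * q ^ degree P * Z\<bar>
      \<le> real (2 * degree P) * 1 + 4 * real (card {[:\<alpha>:]})"
  proof (rule sum_L_val_approx[OF P order_refl])
    fix n assume n: "n < 2 * degree P"
    have "(\<Sum>f | f \<in> monics n \<and> pderiv f \<noteq> 0.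
        \<bar>(\<Sum>F\<in>{[:\<alpha>:]}. chi_inf F f) * (\<Sum>a\<in>polys_below (degree P) - {0}. chi_fin P a f)\<bar>)
        \<le> (\<Sum>f | f \<in> monics n \<and> pderiv (f :: 'a poly) \<noteq> 0. 1)"
    proof (rule sum_mono)
      fix f :: "'a poly" assume f: "f \<in> {f. f \<in> monics n \<and> pderiv f \<noteq> 0}"
      have "degree (pderiv f) \<le> degree f" using degree_pderiv_less[of f] by (cases "degree f = 0") (auto elim!: degree_eq_zeroE simp: pderiv_pCons)
      then have "degree (pderiv f) < 2 * degree P" using f n by (simp add: monics_def)
      with sum_chi_fin_abs_le[OF P] f
      show "\<bar>(\<Sum>F\<in>{[:\<alpha>:]}. chi_inf F f) * (\<Sum>a\<in>polys_below (degree P) - {0}. chi_fin P a f)\<bar> \<le> 1"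
        by (simp add: abs_mult abs_chi_inf)
    qed
    also have "\<dots> \<le> real (card (monics n :: 'a poly set))"
      by (simp add: card_mono)
    finally show "(\<Sum>f | f \<in> monics n \<and> pderiv f \<noteq> 0.
        \<bar>(\<Sum>F\<in>{[:\<alpha>:]}. chi_inf F f) * (\<Sum>a\<in>polys_below (degree P) - {0}. chi_fin P a f)\<bar>) \<le> 1 * q ^ n"
      by (simp add: card_monics)
  qed
  then show ?thesis by simp
qed

text \<open>Otherwise some translation E of \<open>G_set\<close> has \<open>chi_inf E f\<close> = -1
  and the sum cancels. For odd n take the constant \<open>\<xi>\<close>. For even n put d = deg f',
  which is even; if d + 2s > n, then n - d = 2j with 1 <= j < s, and a suitable multiple of T^(2j -
  1) makes the coefficient of E f' at n - 1 equal to \<open>\<xi>\<close>.\<close>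

lemma sum_chi_inf_nonzero:
  fixes f :: "'a poly"
  assumes f: "f \<in> monics n" "pderiv f \<noteq> 0" and nz: "(\<Sum>F\<in>G_set \<xi> s. chi_inf F f) \<noteq> 0"
  shows "even n \<and> degree (pderiv f) + 2 * s \<le> n"
proof -
  have no_flip: False if "chi_inf E f = - 1" "\<And>F. F \<in> G_set \<xi> s \<Longrightarrow> F + E \<in> G_set \<xi> s" for E
  proof -
    have "(\<Sum>F\<in>G_set \<xi> s. chi_inf F f) = 0"
      by (rule sum_involution_eq_0[where t = "\<lambda>F. F + E"])
        (use that in \<open>auto simp: add.assoc chi_inf_add\<close>)
    with nz show False by simp
  qed
  have "even n"
  proof (rule ccontr)
    assume "odd n"
    then have "chi_inf [:\<xi>:] f = - 1" using chi_inf_const[OF f(1)] by simp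
    then show False by (rule no_flip) (rule G_set_add_const, auto)
  qed
  moreover have "degree (pderiv f) + 2 * s \<le> n"
  proof (rule ccontr)
    assume contr: "\<not> degree (pderiv f) + 2 * s \<le> n"
    define d where "d = degree (pderiv f)"
    have dn: "d < n" unfolding d_def
      using f degree_pderiv_less[of f] by (cases "degree f = 0") (auto elim!: degree_eq_zeroE simp: pderiv_pCons monics_def)
    have "even d" unfolding d_def by (rule even_degree_pderiv)
    then obtain j where j: "n = d + 2 * j" using \<open>even n\<close> dn
      by (metis dvd_diff_nat dvdE le_add_diff_inverse less_imp_le)
    have j1: "j \<ge> 1" "j < s" using j dn contr by (auto simp: d_def)
    define E where "E = monom (\<xi> / lead_coeff (pderiv f)) (2 * j - 1)"
    have lc: "lead_coeff (pderiv f) \<noteq> 0" using f(2) by simp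
    have degE: "degree E = 2 * j - 1" using lc \<xi>_nonzero by (simp add: E_def degree_monom_eq)
    have "degree (E * pderiv f) \<le> n - 1"
      using degree_mult_le[of E "pderiv f"] j j1 unfolding degE d_def by linarith
    then have "res f (E * pderiv f) = coeff (E * pderiv f) (n - 1)"
      using f(1) dn by (subst res_degree_less) (auto simp: monics_def)
    also have "n - 1 = (2 * j - 1) + d" using j j1 by simp
    also have "coeff (E * pderiv f) ((2 * j - 1) + d) = coeff E (2 * j - 1) * coeff (pderiv f) d"
      by (rule coeff_mult_top) (auto simp: degE d_def)
    also have "\<dots> = \<xi>" using lc by (simp add: E_def d_def)
    finally have "chi_inf E f = - 1" by (simp add: chi_inf_def)
    then show False by (rule no_flip) (unfold E_def, rule G_set_add_monom[OF _ j1])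
  qed
  ultimately show ?thesis ..
qed

text \<open>Write n = 2m and f = A^2 + T B^2. Then deg A <= m and deg B <= m - s leave at most
  q^(m+1) q^(m-s+1) choices. The saving q^s offsets the size of
  \<open>G_set \<xi> s\<close>.\<close>

lemma card_small_pderiv:
  assumes "s \<ge> 1"
  shows "card {f \<in> monics n. even n \<and> degree (pderiv (f :: 'a poly)) + 2 * s \<le> n} * CARD('a) ^ s
       \<le> CARD('a) ^ (n + 2)"
proof (cases "even n \<and> 2 * s \<le> n")
  case False
  then have "{f \<in> monics n. even n \<and> degree (pderiv (f :: 'a poly)) + 2 * s \<le> n} = {}" by auto
  then show ?thesis by (simp only: card.empty mult_0 zero_le)
next
  case True
  then obtain m where m: "n = 2 * m" by (auto elim: evenE)
  have sm: "s \<le> m" using True m by simp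
  let ?U = "polys_below (m + 1) \<times> polys_below (m - s + 1) :: ('a poly \<times> 'a poly) set"
  have "{f \<in> monics n. even n \<and> degree (pderiv (f :: 'a poly)) + 2 * s \<le> n}
      \<subseteq> (\<lambda>(A, B). A\<^sup>2 + [:0, 1:] * B\<^sup>2) ` ?U"
  proof
    fix f :: "'a poly" assume f: "f \<in> {f \<in> monics n. even n \<and> degree (pderiv f) + 2 * s \<le> n}"
    obtain A B where AB: "f = A\<^sup>2 + [:0, 1:] * B\<^sup>2" using even_odd_decomp by blast
    then have "pderiv f = B\<^sup>2" using pderiv_decomp by metis
    with f have B: "2 * degree B + 2 * s \<le> 2 * m"
      by (cases "B = 0") (auto simp: degree_power_eq m)
    have "A\<^sup>2 = f - [:0, 1:] * B\<^sup>2" using AB by (simp del: diff_eq_add)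
    also have "degree \<dots> \<le> 2 * m"
    proof (rule degree_diff_le)
      show "degree f \<le> 2 * m" using f m by (simp add: monics_def)
      have "degree ([:0, 1:] * B\<^sup>2) \<le> 1 + 2 * degree B"
        using degree_mult_le[of "[:0, 1:]" "B\<^sup>2"] degree_power_le[of B 2] by simp
      then show "degree ([:0, 1:] * B\<^sup>2) \<le> 2 * m" using B assms by simp
    qed
    finally have "degree A \<le> m" by (cases "A = 0") (auto simp: degree_power_eq)
    then have "A \<in> polys_below (m + 1)" by (simp add: polys_below_iff)
    moreover have "degree B + s \<le> m" using B by simp
    then have "B \<in> polys_below (m - s + 1)" using sm by (auto simp: polys_below_iff)
    ultimately show "f \<in> (\<lambda>(A, B). A\<^sup>2 + [:0, 1:] * B\<^sup>2) ` ?U" using AB by auto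
  qed
  then have "card {f \<in> monics n. even n \<and> degree (pderiv (f :: 'a poly)) + 2 * s \<le> n} \<le> card ?U"
    by (intro surj_card_le) auto
  also have "\<dots> = CARD('a) ^ (m + 1 + (m - s + 1))"
    by (simp add: card_cartesian_product card_polys_below power_add)
  finally have "card {f \<in> monics n. even n \<and> degree (pderiv (f :: 'a poly)) + 2 * s \<le> n} * CARD('a) ^ s
      \<le> CARD('a) ^ (m + 1 + (m - s + 1)) * CARD('a) ^ s" by (rule mult_le_mono1)
  also have "\<dots> = CARD('a) ^ (n + 2)" using sm by (simp add: m mult_2 flip: power_add)
  finally show ?thesis .
qed

lemma card_G_set: "s \<ge> 1 \<Longrightarrow> real (card (G_set \<xi> s)) = 2 * (q - 1) * q ^ (s - 1)"
  using finite_card_G_set[OF \<xi>_nonzero, of s] card_finite_field_ge_2[where 'a = 'a]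
  by (simp add: of_nat_diff)

text \<open>The main term has no zeta value because 2 (q - 1) q^(s-1) Z = 2 q^s. Although n may
  exceed 2 deg P, an \<open>f\<close> that survives the sum over \<open>F\<close> has deg f' <= n -
  2s < 2 deg P, so the bound 1 for the sum over \<open>a\<close> still applies.\<close>

lemma sum_L_val_ramified:
  fixes P :: "'a poly"
  assumes P: "lead_coeff P = 1" "irreducible P" and s: "s \<ge> 1"
  shows "\<bar>(\<Sum>F\<in>G_set \<xi> s. \<Sum>a\<in>polys_below (degree P) - {0}. L_val P a F (2 * degree P + 2 * s - 1))
       - 2 * q ^ (degree P + s)\<bar> \<le> 4 * q\<^sup>2 * (degree P + s) + 8 * q ^ s"
proof -
  define N where "N = 2 * degree P + 2 * s - 1"
  define G where "G = real (card (G_set \<xi> s))"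
  have q0: "q > 0" using q_ge_2 by simp
  have qs: "q ^ s = q * q ^ (s - 1)" using s by (cases s) auto
  have G: "G = 2 * (q - 1) * q ^ (s - 1)" unfolding G_def using card_G_set s by blast
  have G_le: "G \<le> 2 * q ^ s" unfolding G qs using q0 by (simp add: algebra_simps)
  have "\<bar>(\<Sum>F\<in>G_set \<xi> s. \<Sum>a\<in>polys_below (degree P) - {0}. L_val P a F N)
      - real (card (G_set \<xi> s)) * q ^ degree P * Z\<bar> \<le> real N * (2 * q\<^sup>2) + 4 * real (card (G_set \<xi> s))"
  proof (rule sum_L_val_approx[OF P])
    show "2 * degree P \<le> N" using s by (simp add: N_def)
    fix n assume n: "n < N"
    let ?B = "{f \<in> monics n. even n \<and> degree (pderiv (f :: 'a poly)) + 2 * s \<le> n}"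
    let ?t = "\<lambda>f. \<bar>(\<Sum>F\<in>G_set \<xi> s. chi_inf F f) * (\<Sum>a\<in>polys_below (degree P) - {0}. chi_fin P a f)\<bar>"
    have "(\<Sum>f | f \<in> monics n \<and> pderiv f \<noteq> 0. ?t f) \<le> (\<Sum>f | f \<in> monics n \<and> pderiv (f :: 'a poly) \<noteq> 0. if f \<in> ?B then G else 0)"
    proof (rule sum_mono)
      fix f :: "'a poly" assume f: "f \<in> {f. f \<in> monics n \<and> pderiv f \<noteq> 0}"
      show "?t f \<le> (if f \<in> ?B then G else 0)"
      proof (cases "(\<Sum>F\<in>G_set \<xi> s. chi_inf F f) = 0")
        case True
        then show ?thesis by (simp add: G_def)
      next
        case False
        then have B: "f \<in> ?B" using sum_chi_inf_nonzero f by blast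
        then have "degree (pderiv f) + 2 * s \<le> n" by simp
        then have "degree (pderiv f) < 2 * degree P" using n s unfolding N_def by linarith
        then have 1: "\<bar>\<Sum>a\<in>polys_below (degree P) - {0}. chi_fin P a f\<bar> \<le> 1"
          using sum_chi_fin_abs_le[OF P] f by blast
        have "\<bar>\<Sum>F\<in>G_set \<xi> s. chi_inf F f\<bar> \<le> (\<Sum>F\<in>G_set \<xi> s. \<bar>chi_inf F f\<bar>)" by (rule sum_abs)
        also have "\<dots> = G" by (simp add: abs_chi_inf G_def)
        finally have "?t f \<le> G * 1" unfolding abs_mult using 1 by (intro mult_mono) (auto simp: G_def)
        with B show ?thesis by simp
      qed
    qed
    also have "\<dots> = G * card ({f. f \<in> monics n \<and> pderiv f \<noteq> 0} \<inter> ?B)"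
      by (subst sum.If_cases) (simp_all only: Collect_mem_eq, simp_all)
    also have "\<dots> \<le> G * card ?B"
      by (intro mult_left_mono of_nat_mono card_mono) (auto simp: G_def)
    also have "\<dots> \<le> 2 * q ^ s * card ?B" using G_le by (rule mult_right_mono) simp
    also have "\<dots> = 2 * real (card ?B * CARD('a) ^ s)" by simp
    also have "\<dots> \<le> 2 * real (CARD('a) ^ (n + 2))"
      using card_small_pderiv[OF s] by (intro mult_left_mono of_nat_mono) auto
    also have "\<dots> = 2 * q\<^sup>2 * q ^ n" by (simp add: power_add power2_eq_square)
    finally show "(\<Sum>f | f \<in> monics n \<and> pderiv f \<noteq> 0. ?t f) \<le> 2 * q\<^sup>2 * q ^ n" .
  qed
  moreover have "real (card (G_set \<xi> s)) * q ^ degree P * Z = 2 * q ^ (degree P + s)"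
    unfolding G_def[symmetric] G Z_def using q_ge_2 by (simp add: power_add qs field_simps)
  moreover have "real N * (2 * q\<^sup>2) \<le> 4 * q\<^sup>2 * (degree P + s)"
  proof -
    have "real N \<le> 2 * (degree P + s)" by (simp add: N_def)
    from mult_right_mono[OF this, of "2 * q\<^sup>2"] show ?thesis by (simp add: algebra_simps)
  qed
  ultimately show ?thesis using G_le unfolding N_def G_def by linarith
qed

end

subsection \<open>Asymptotics\<close>

text \<open>\<open>P\<close> is recovered as the denominator; then a - a' is a multiple of
  \<open>P\<close> of smaller degree, hence 0. This turns sums over the set of all u into iterated
  sums.\<close>

lemma inj_on_Fract_add_poly:
  "inj_on (\<lambda>(r, P, F, a). Fract a P + to_fract F)
    {(r, P, F, a). P \<in> monic_irreducibles r \<and> a \<in> polys_below r - {0 :: 'a::field poly}}"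
proof (rule inj_onI, clarsimp)
  fix r r' :: nat and P P' F F' a a' :: "'a poly"
  assume P: "P \<in> monic_irreducibles r" "P' \<in> monic_irreducibles r'"
    and a: "a \<in> polys_below r" "a \<noteq> 0" "a' \<in> polys_below r'" "a' \<noteq> 0"
    and eq: "Fract a P + to_fract F = Fract a' P' + to_fract F'"
  have *: "Fract a P + to_fract F = Fract (a + F * P) P \<and> denominator (Fract (a + F * P) P) = P"
    if "P \<in> monic_irreducibles r" "a \<in> polys_below r" "a \<noteq> 0" for P a F :: "'a poly" and r
  proof -
    have P: "lead_coeff P = 1" "irreducible P" "degree P = r"
      using that(1) by (auto simp: monic_irreducibles_def)
    have "\<not> P dvd a" using that P by (auto simp: polys_below_iff dest: dvd_imp_degree_le)
    then have "\<not> P dvd a + F * P" by (simp add: dvd_add_left_iff)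
    with denominator_Fract[OF P(1,2)] have "denominator (Fract (a + F * P) P) = P" by blast
    moreover have "P \<noteq> 0" using P by auto
    ultimately show ?thesis by (simp add: to_fract_def)
  qed
  have PP: "P' = P" using *[OF P(1) a(1,2)] *[OF P(2) a(3,4)] eq by metis
  then have rr: "r' = r" using P by (simp add: monic_irreducibles_def)
  have dP: "degree P = r" and P0: "P \<noteq> 0" using P(1) by (auto simp: monic_irreducibles_def)
  have "Fract (a + F * P) P = Fract (a' + F' * P) P"
    using *[OF P(1) a(1,2)] *[OF P(2) a(3,4)] eq PP by metis
  then have "a + F * P = a' + F' * P" using P0 by (simp add: eq_fract)
  then have diff: "a - a' = P * (F' - F)" by (simp add: algebra_simps)
  then have "P dvd a - a'" by simp
  moreover have "a - a' \<in> polys_below r" using a rr by (intro polys_below_diff) auto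
  ultimately have "a - a' = 0" using dP by (auto simp: polys_below_iff dest: dvd_imp_degree_le)
  moreover from this have "F' - F = 0" using diff P0 by simp
  ultimately show "r = r' \<and> P = P' \<and> F = F' \<and> a = a'" using PP rr by simp
qed

lemma sum_Sigma4:
  assumes "finite A" "\<And>a. a \<in> A \<Longrightarrow> finite (B a)" "\<And>a b. a \<in> A \<Longrightarrow> b \<in> B a \<Longrightarrow> finite (C a b)"
    "\<And>a b c. a \<in> A \<Longrightarrow> b \<in> B a \<Longrightarrow> c \<in> C a b \<Longrightarrow> finite (D a b c)"
  shows "(\<Sum>(a, b, c, d)\<in>(SIGMA a:A. SIGMA b:B a. SIGMA c:C a b. D a b c). f a b c d)
    = (\<Sum>a\<in>A. \<Sum>b\<in>B a. \<Sum>c\<in>C a b. \<Sum>d\<in>D a b c. f a b c d)"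
proof -
  have "(\<Sum>a\<in>A. \<Sum>b\<in>B a. \<Sum>c\<in>C a b. \<Sum>d\<in>D a b c. f a b c d)
    = (\<Sum>a\<in>A. \<Sum>b\<in>B a. \<Sum>(c, d)\<in>(SIGMA c:C a b. D a b c). f a b c d)"
    using assms by (intro sum.cong refl sum.Sigma) auto
  also have "\<dots> = (\<Sum>a\<in>A. \<Sum>(b, c, d)\<in>(SIGMA b:B a. SIGMA c:C a b. D a b c). f a b c d)"
    using assms by (intro sum.cong refl sum.Sigma) auto
  also have "\<dots> = (\<Sum>(a, b, c, d)\<in>(SIGMA a:A. SIGMA b:B a. SIGMA c:C a b. D a b c). f a b c d)"
    using assms by (intro sum.Sigma) auto
  finally show ?thesis ..
qed

text \<open>The comparison term is essentially the geometric sum with every 1/r replaced by 1/g. The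
  induction closes because the bound grows by a factor near q >= 2: after using C >= 5, the step
  needs 1/(2x^2) + 1/(5x(x+1)) <= 1/(x+1)^2, which holds for x >= 5.\<close>

lemma sum_powers_over_index:
  fixes q :: real
  assumes q: "q \<ge> 2"
  obtains C where "\<And>g. g \<ge> 1 \<Longrightarrow> \<bar>(\<Sum>r=1..g. q ^ r / r) - q ^ (g + 1) / ((q - 1) * g)\<bar> \<le> C * (q ^ g / (real g)\<^sup>2)"
proof -
  define d where "d g = \<bar>(\<Sum>r=1..g. q ^ r / r) - q ^ (g + 1) / ((q - 1) * g)\<bar>" for g :: nat
  define b where "b g = q ^ g / (real g)\<^sup>2" for g :: nat
  have b: "b g > 0" if "g \<ge> 1" for g using q that by (simp add: b_def)
  \<comment> \<open>The sum absorbs the cases g <= 5; the summand 5 lets the new error of each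
    induction step be absorbed.\<close>
  define C where "C = 5 + (\<Sum>g=1..5. d g / b g)"
  have d0: "d g \<ge> 0" for g by (simp add: d_def)
  have C5: "C \<ge> 5" unfolding C_def using b d0 by (auto intro!: sum_nonneg divide_nonneg_pos)
  have small: "d g \<le> C * b g" if "1 \<le> g" "g \<le> 5" for g
  proof -
    have "d g / b g \<le> (\<Sum>g=1..5. d g / b g)"
      using that b d0 by (intro member_le_sum) (auto intro!: divide_nonneg_pos)
    then have "d g / b g \<le> C" by (simp add: C_def)
    then show ?thesis using b[OF that(1)] by (simp add: pos_divide_le_eq)
  qed
  have "d g \<le> C * b g" if "g \<ge> 5" for g
    using that
  proof (induction g rule: dec_induct)
    case base
    then show ?case using small by simp
  next
    case (step g)
    define x where "x = real g"
    have x: "x \<ge> 5" using step(1) by (simp add: x_def)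
    have q1: "q - 1 > 0" using q by simp
    \<comment> \<open>The new summand minus the increment of the comparison term: the leading parts
      cancel and 1/(x(x+1)) remains.\<close>
    have "q ^ (g + 1) / (x + 1) - q ^ (g + 2) / ((q - 1) * (x + 1)) + q ^ (g + 1) / ((q - 1) * x)
        = q ^ (g + 1) / ((q - 1) * (x * (x + 1)))"
    proof -
      have "q ^ (g + 1) / (x + 1) - q ^ (g + 2) / ((q - 1) * (x + 1)) + q ^ (g + 1) / ((q - 1) * x)
         = q ^ (g + 1) * (1 / (x + 1) - q / ((q - 1) * (x + 1)) + 1 / ((q - 1) * x))"
        by (simp add: algebra_simps)
      also have "1 / (x + 1) - q / ((q - 1) * (x + 1)) + 1 / ((q - 1) * x) = 1 / ((q - 1) * (x * (x + 1)))"
        using x q1 by (simp add: divide_simps)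
      finally show ?thesis by simp
    qed
    moreover have "d (Suc g) = \<bar>(\<Sum>r=1..g. q ^ r / r) + q ^ (g + 1) / (x + 1) - q ^ (g + 2) / ((q - 1) * (x + 1))\<bar>"
      by (simp add: d_def x_def add_ac)
    ultimately have "d (Suc g) = \<bar>((\<Sum>r=1..g. q ^ r / r) - q ^ (g + 1) / ((q - 1) * x))
        + q ^ (g + 1) / ((q - 1) * (x * (x + 1)))\<bar>"
      by linarith
    also have "\<dots> \<le> d g + q ^ (g + 1) / ((q - 1) * (x * (x + 1)))"
      using abs_triangle_ineq[of "(\<Sum>r=1..g. q ^ r / r) - q ^ (g + 1) / ((q - 1) * x)" "q ^ (g + 1) / ((q - 1) * (x * (x + 1)))"] x q
      by (simp add: d_def x_def)
    also have "d g + q ^ (g + 1) / ((q - 1) * (x * (x + 1))) \<le> d g + q ^ (g + 1) / (1 * (x * (x + 1)))"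
      using x q by (intro add_left_mono divide_left_mono mult_right_mono mult_pos_pos) auto
    also have "d g + q ^ (g + 1) / (1 * (x * (x + 1))) \<le> C * b g + q ^ (g + 1) / (1 * (x * (x + 1)))"
      using step.IH by simp
    also have "C * b g = C * q ^ (g + 1) * (1 / (q * x\<^sup>2))"
      using q by (simp add: b_def x_def)
    also have "\<dots> + q ^ (g + 1) / (1 * (x * (x + 1))) \<le> C * q ^ (g + 1) * (1 / (2 * x\<^sup>2)) + C * q ^ (g + 1) * (1 / (5 * (x * (x + 1))))"
    proof (rule add_mono)
      show "C * q ^ (g + 1) * (1 / (q * x\<^sup>2)) \<le> C * q ^ (g + 1) * (1 / (2 * x\<^sup>2))"
        using q x C5 by (intro mult_left_mono divide_left_mono mult_right_mono) auto
      have "5 * (q ^ (g + 1) * (1 / (5 * (x * (x + 1))))) \<le> C * (q ^ (g + 1) * (1 / (5 * (x * (x + 1)))))"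
        using C5 q x by (intro mult_right_mono) auto
      then show "q ^ (g + 1) / (1 * (x * (x + 1))) \<le> C * q ^ (g + 1) * (1 / (5 * (x * (x + 1))))"
        using x by (simp add: mult.assoc)
    qed
    also have "\<dots> = C * q ^ (g + 1) * (1 / (2 * x\<^sup>2) + 1 / (5 * (x * (x + 1))))"
      by (simp add: distrib_left)
    also have "\<dots> \<le> C * q ^ (g + 1) * (1 / (x + 1)\<^sup>2)"
    proof (intro mult_left_mono)
      have "5 * (x + 1)\<^sup>2 + 2 * x * (x + 1) \<le> 10 * x\<^sup>2"
      proof -
        have "0 \<le> (x - 5) * (3 * x + 3)" using x by simp
        then show ?thesis using x by (simp add: power2_eq_square algebra_simps)
      qed
      then have "(5 * (x + 1)\<^sup>2 + 2 * x * (x + 1)) / (10 * x\<^sup>2 * (x + 1)\<^sup>2) \<le> 10 * x\<^sup>2 / (10 * x\<^sup>2 * (x + 1)\<^sup>2)"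
        by (rule divide_right_mono) simp
      moreover have "(5 * (x + 1)\<^sup>2 + 2 * x * (x + 1)) / (10 * x\<^sup>2 * (x + 1)\<^sup>2) = 1 / (2 * x\<^sup>2) + 1 / (5 * (x * (x + 1)))"
        using x by (simp add: divide_simps power2_eq_square) (simp add: algebra_simps)
      moreover have "10 * x\<^sup>2 / (10 * x\<^sup>2 * (x + 1)\<^sup>2) = 1 / (x + 1)\<^sup>2" using x by simp
      ultimately show "1 / (2 * x\<^sup>2) + 1 / (5 * (x * (x + 1))) \<le> 1 / (x + 1)\<^sup>2" by simp
    qed (use C5 q in auto)
    also have "\<dots> = C * b (Suc g)" by (simp add: b_def x_def add.commute)
    finally show ?case .
  qed
  with small have "d g \<le> C * b g" if "g \<ge> 1" for g using that by (cases "g \<le> 5") auto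
  then show ?thesis using that[of C] unfolding d_def b_def by blast
qed

context even_field
begin

lemma sqrt_q: "sqrt q ^ (2 * n) = q ^ n" "sqrt q \<ge> 1"
  using q_ge_2 by (simp_all add: power_mult)

lemma card_monic_irreducibles_real:
  assumes "n > 0"
  shows "real n * real (card (monic_irreducibles n :: 'a poly set)) \<le> q ^ n"
    "real (card (monic_irreducibles n :: 'a poly set)) \<le> q ^ n"
    "\<bar>real (card (monic_irreducibles n :: 'a poly set)) - q ^ n / n\<bar> \<le> 2 * sqrt q ^ n"
proof -
  let ?c = "card (monic_irreducibles n :: 'a poly set)"
  show 1: "real n * real ?c \<le> q ^ n"
    using of_nat_mono[OF card_monic_irreducibles_le[of n, where 'a = 'a], where 'a = real] by simp
  have "1 * real ?c \<le> real n * real ?c" using assms by (intro mult_right_mono) auto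
  with 1 show "real ?c \<le> q ^ n" by simp
  show "\<bar>real ?c - q ^ n / n\<bar> \<le> 2 * sqrt q ^ n"
    using prime_polynomial_theorem[OF assms, where 'a = 'a] by simp
qed

lemma F'_at_eq:
  assumes "P \<in> monic_irreducibles r"
  shows "F'_at \<alpha> P = (\<lambda>a. Fract a P + to_fract [:\<alpha>:]) ` (polys_below r - {0 :: 'a poly})"
  using assms unfolding F'_at_def F_at_def monic_irreducibles_def
  by (auto simp: polys_below_iff image_iff)

lemma sum_L_fun_F'_at:
  fixes P :: "'a poly"
  assumes P: "P \<in> monic_irreducibles r"
  shows "(\<Sum>u\<in>F'_at \<alpha> P. L_fun 1 u)
       = complex_of_real (\<Sum>a\<in>polys_below (degree P) - {0}. L_val P a [:\<alpha>:] (2 * degree P))"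
proof -
  have P': "lead_coeff P = 1" "irreducible P" "degree P = r"
    using P by (auto simp: monic_irreducibles_def)
  have "P \<noteq> 0" using P' by auto
  then have "inj_on (\<lambda>a. Fract a P + to_fract [:\<alpha>:]) (polys_below r - {0})"
    by (auto simp: inj_on_def eq_fract)
  then have "(\<Sum>u\<in>F'_at \<alpha> P. L_fun 1 u) = (\<Sum>a\<in>polys_below r - {0}. L_fun 1 (Fract a P + to_fract [:\<alpha>:]))"
    unfolding F'_at_eq[OF P] by (simp add: sum.reindex)
  also have "\<dots> = (\<Sum>a\<in>polys_below r - {0}. complex_of_real (L_val P a [:\<alpha>:] (2 * degree P)))"
    using sum_char_const_eq_0[OF P'(1,2)] P'(3)
    by (intro sum.cong refl L_fun_eq_L_val[OF P'(1,2)]) auto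
  finally show ?thesis by (simp add: P'(3))
qed

text \<open>10 = 6 + 4: the errors 2r + 4 of the individual primes add up to at most 6 q^r, and the
  error 2 sqrt(q)^r in the prime count is multiplied by Z q^r <= 2 q^r. The latter fixes the
  exponent 3/2.\<close>

lemma sum_L_fun_F'_at_asymp:
  assumes r: "r > 0"
  shows "norm ((\<Sum>P\<in>(monic_irreducibles r :: 'a poly set). \<Sum>u\<in>F'_at \<alpha> P. L_fun 1 u)
      - complex_of_real (Z * (q ^ (2 * r) / r))) \<le> 10 * sqrt q ^ (3 * r)"
proof -
  let ?M = "monic_irreducibles r :: 'a poly set"
  let ?T = "\<lambda>P. \<Sum>a\<in>polys_below (degree P) - {0}. L_val P a [:\<alpha>:] (2 * degree P)"
  define c where "c = real (card ?M)"
  have "\<bar>(\<Sum>P\<in>?M. ?T P) - c * (q ^ r * Z)\<bar> = \<bar>\<Sum>P\<in>?M. ?T P - q ^ r * Z\<bar>"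
    by (simp add: sum_subtractf c_def)
  also have "\<dots> \<le> (\<Sum>P\<in>?M. 2 * real r + 4)"
  proof (intro order_trans[OF sum_abs] sum_mono)
    fix P assume "P \<in> ?M"
    then have "lead_coeff P = 1" "irreducible P" "degree P = r" by (auto simp: monic_irreducibles_def)
    then show "\<bar>?T P - q ^ r * Z\<bar> \<le> 2 * real r + 4" using sum_L_val_const[of P \<alpha>] by simp
  qed
  also have "\<dots> = c * (2 * real r + 4)" by (simp add: c_def)
  also have "\<dots> \<le> 6 * (real r * c)"
  proof -
    have "c * (2 * real r + 4) \<le> c * (6 * real r)" using r by (intro mult_left_mono) (auto simp: c_def)
    then show ?thesis by (simp add: mult_ac)
  qed
  also have "\<dots> \<le> 6 * q ^ r" using card_monic_irreducibles_real(1)[OF r] by (simp add: c_def)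
  also have "q ^ r \<le> sqrt q ^ (3 * r)"
    unfolding sqrt_q(1)[symmetric] by (intro power_increasing sqrt_q) simp
  finally have 1: "\<bar>(\<Sum>P\<in>?M. ?T P) - c * (q ^ r * Z)\<bar> \<le> 6 * sqrt q ^ (3 * r)" by simp
  have "q ^ (2 * r) = q ^ r * q ^ r" by (simp add: mult_2 power_add)
  then have "c * (q ^ r * Z) - Z * (q ^ (2 * r) / r) = (Z * q ^ r) * (c - q ^ r / r)"
    by (simp only:) (simp add: algebra_simps)
  also have "\<bar>\<dots>\<bar> \<le> (2 * q ^ r) * (2 * sqrt q ^ r)"
    unfolding abs_mult using card_monic_irreducibles_real(3)[OF r] Z_bounds q_ge_2
    by (intro mult_mono) (auto simp: c_def)
  also have "\<dots> = 4 * sqrt q ^ (2 * r + r)" unfolding power_add sqrt_q by simp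
  also have "2 * r + r = 3 * r" by simp
  finally have "\<bar>c * (q ^ r * Z) - Z * (q ^ (2 * r) / r)\<bar> \<le> 4 * sqrt q ^ (3 * r)" .
  then have "\<bar>(\<Sum>P\<in>?M. ?T P) - Z * (q ^ (2 * r) / r)\<bar> \<le> 10 * sqrt q ^ (3 * r)"
    using 1 by linarith
  moreover have "(\<Sum>P\<in>?M. \<Sum>u\<in>F'_at \<alpha> P. L_fun 1 u) = complex_of_real (\<Sum>P\<in>?M. ?T P)"
    by (simp add: sum_L_fun_F'_at)
  ultimately show ?thesis by (simp only: of_real_diff[symmetric] norm_of_real)
qed

section \<open>The family \<open>H_set\<close>\<close>

lemma sum_L_fun_H_set:
  "(\<Sum>u\<in>H_set \<xi> (g + 1). L_fun 1 u)
   = complex_of_real (\<Sum>r=1..g. \<Sum>P\<in>monic_irreducibles r. \<Sum>F\<in>G_set \<xi> (g + 1 - r).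
       \<Sum>a\<in>polys_below (degree P) - {0}. L_val P a F (2 * degree P + 2 * (g + 1 - r) - 1))"
proof -
  let ?\<Phi> = "\<lambda>(r :: nat, P, F, a). Fract a P + to_fract F"
  define I where "I = (SIGMA r:{1..g}. SIGMA P:(monic_irreducibles r :: 'a poly set). SIGMA F:G_set \<xi> (g + 1 - r). polys_below r - {0 :: 'a poly})"
  have H: "H_set \<xi> (g + 1) = ?\<Phi> ` I"
  proof (intro set_eqI iffI)
    fix u assume "u \<in> H_set \<xi> (g + 1)"
    then obtain r P a F where "r \<in> {1..g}" "P \<in> monic_irreducibles r" "F \<in> G_set \<xi> (g + 1 - r)"
      "a \<noteq> 0" "degree a < degree P" "u = Fract a P + to_fract F"
      by (auto simp: H_set_def H_pair_def F_deg_def F_at_def)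
    then have "(r, P, F, a) \<in> I" "u = ?\<Phi> (r, P, F, a)"
      by (auto simp: I_def polys_below_iff monic_irreducibles_def)
    then show "u \<in> ?\<Phi> ` I" by blast
  next
    fix u assume "u \<in> ?\<Phi> ` I"
    then obtain t where "t \<in> I" "u = ?\<Phi> t" by blast
    moreover obtain r P F a where "t = (r, P, F, a)" by (cases t)
    ultimately have *: "r \<in> {1..g}" "P \<in> monic_irreducibles r" "F \<in> G_set \<xi> (g + 1 - r)"
      "a \<in> polys_below r" "a \<noteq> 0" "u = Fract a P + to_fract F"
      by (auto simp: I_def)
    then have "degree a < degree P" by (simp add: polys_below_iff monic_irreducibles_def)
    then have "Fract a P \<in> F_deg r" using * unfolding F_deg_def F_at_def by blast
    then have "u \<in> H_pair \<xi> r (g + 1 - r)" using * unfolding H_pair_def by blast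
    then show "u \<in> H_set \<xi> (g + 1)" using *(1) unfolding H_set_def by auto
  qed
  have "inj_on ?\<Phi> I"
    by (rule inj_on_subset[OF inj_on_Fract_add_poly]) (auto simp: I_def)
  then have "(\<Sum>u\<in>H_set \<xi> (g + 1). L_fun 1 u) = (\<Sum>(r, P, F, a)\<in>I. L_fun 1 (Fract a P + to_fract F))"
    unfolding H by (subst sum.reindex) (auto simp: case_prod_unfold)
  also have "\<dots> = (\<Sum>(r, P, F, a)\<in>I. complex_of_real (L_val P a F (2 * degree P + 2 * (g + 1 - r) - 1)))"
  proof (intro sum.cong refl, clarify)
    fix r P F a assume "(r, P, F, a) \<in> I"
    then have *: "r \<in> {1..g}" "lead_coeff P = 1" "irreducible P" "F \<in> G_set \<xi> (g + 1 - r)"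
      "a \<in> polys_below (degree P)" "a \<noteq> 0"
      by (auto simp: I_def monic_irreducibles_def)
    have s: "g + 1 - r \<ge> 1" using *(1) by auto
    show "L_fun 1 (Fract a P + to_fract F) = complex_of_real (L_val P a F (2 * degree P + 2 * (g + 1 - r) - 1))"
      by (rule L_fun_eq_L_val[OF *(2,3,5,6)], rule sum_char_eq_0[OF *(2,3) G_set_degree[OF *(4) s] s])
  qed
  also have "\<dots> = (\<Sum>r=1..g. \<Sum>P\<in>monic_irreducibles r. \<Sum>F\<in>G_set \<xi> (g + 1 - r).
       \<Sum>a\<in>polys_below r - {0}. complex_of_real (L_val P a F (2 * degree P + 2 * (g + 1 - r) - 1)))"
  proof -
    have fin: "finite (G_set \<xi> (g + 1 - r))" if "r \<in> {1..g}" for r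
      using finite_card_G_set[OF \<xi>_nonzero, of "g + 1 - r"] that by auto
    show ?thesis unfolding I_def using fin by (intro sum_Sigma4) auto
  qed
  also have "\<dots> = complex_of_real (\<Sum>r=1..g. \<Sum>P\<in>monic_irreducibles r. \<Sum>F\<in>G_set \<xi> (g + 1 - r).
       \<Sum>a\<in>polys_below (degree P) - {0}. L_val P a F (2 * degree P + 2 * (g + 1 - r) - 1))"
    unfolding of_real_sum by (intro sum.cong refl) (simp_all add: monic_irreducibles_def)
  finally show ?thesis .
qed

text \<open>With s = g + 1 - r the main term 2 q^(g+1) per prime is independent of r, so only the
  number of primes of degree r varies. The first error collects the character sums, the second the
  prime counts.\<close>

lemma sum_L_val_H_bound:
  "\<bar>(\<Sum>r=1..g. \<Sum>P\<in>(monic_irreducibles r :: 'a poly set). \<Sum>F\<in>G_set \<xi> (g + 1 - r).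
       \<Sum>a\<in>polys_below (degree P) - {0}. L_val P a F (2 * degree P + 2 * (g + 1 - r) - 1))
     - 2 * q ^ (g + 1) * (\<Sum>r=1..g. q ^ r / r)\<bar>
   \<le> 12 * q ^ (g + 2) * (real g + 1)\<^sup>2 + 4 * q ^ (g + 1) * g * sqrt q ^ g"
proof -
  let ?M = "\<lambda>r. monic_irreducibles r :: 'a poly set"
  let ?T = "\<lambda>r P. \<Sum>F\<in>G_set \<xi> (g + 1 - r). \<Sum>a\<in>polys_below (degree P) - {0}.
      L_val P a F (2 * degree P + 2 * (g + 1 - r) - 1)"
  have q1: "q \<ge> 1" using q_ge_2 by simp
  have "\<bar>(\<Sum>P\<in>?M r. ?T r P) - 2 * q ^ (g + 1) * (q ^ r / r)\<bar>
      \<le> 12 * q ^ (g + 2) * (real g + 1) + 4 * q ^ (g + 1) * sqrt q ^ g" if r: "r \<in> {1..g}" for r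
  proof -
    define c where "c = real (card (?M r))"
    have r0: "r > 0" using r by simp
    have s: "g + 1 - r \<ge> 1" using r by auto
    have "\<bar>(\<Sum>P\<in>?M r. ?T r P) - c * (2 * q ^ (g + 1))\<bar> = \<bar>\<Sum>P\<in>?M r. ?T r P - 2 * q ^ (g + 1)\<bar>"
      by (simp add: sum_subtractf c_def)
    also have "\<dots> \<le> (\<Sum>P\<in>?M r. 4 * q\<^sup>2 * (g + 1) + 8 * q ^ (g + 1 - r))"
    proof (intro order_trans[OF sum_abs] sum_mono)
      fix P assume "P \<in> ?M r"
      then have P: "lead_coeff P = 1" "irreducible P" "degree P = r" by (auto simp: monic_irreducibles_def)
      have "degree P + (g + 1 - r) = g + 1" using r P by simp
      then show "\<bar>?T r P - 2 * q ^ (g + 1)\<bar> \<le> 4 * q\<^sup>2 * (g + 1) + 8 * q ^ (g + 1 - r)"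
        using sum_L_val_ramified[OF P(1,2) s] by (simp only: of_nat_add[symmetric])
    qed
    also have "\<dots> = c * (4 * q\<^sup>2 * (g + 1) + 8 * q ^ (g + 1 - r))" by (simp add: c_def)
    also have "\<dots> \<le> q ^ r * (4 * q\<^sup>2 * (g + 1) + 8 * q ^ (g + 1 - r))"
      using card_monic_irreducibles_real(2)[OF r0] q1 by (intro mult_right_mono) (auto simp: c_def)
    also have "\<dots> = 4 * (q ^ (r + 2) * (real g + 1)) + 8 * q ^ (r + (g + 1 - r))"
      by (simp add: power_add algebra_simps power2_eq_square)
    also have "\<dots> \<le> 4 * (q ^ (g + 2) * (real g + 1)) + 8 * (q ^ (g + 2) * (real g + 1))"
    proof (intro add_mono mult_left_mono)
      show "q ^ (r + 2) * (real g + 1) \<le> q ^ (g + 2) * (real g + 1)"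
        using r q1 by (intro mult_right_mono power_increasing) auto
      have "q ^ (r + (g + 1 - r)) * 1 \<le> q ^ (g + 2) * (real g + 1)"
        using r q1 by (intro mult_mono power_increasing) auto
      then show "q ^ (r + (g + 1 - r)) \<le> q ^ (g + 2) * (real g + 1)" by simp
    qed auto
    finally have 1: "\<bar>(\<Sum>P\<in>?M r. ?T r P) - c * (2 * q ^ (g + 1))\<bar> \<le> 12 * q ^ (g + 2) * (real g + 1)" by simp
    have "\<bar>c - q ^ r / r\<bar> \<le> 2 * sqrt q ^ g"
    proof -
      have "sqrt q ^ r \<le> sqrt q ^ g" using r by (intro power_increasing sqrt_q) auto
      then show ?thesis using card_monic_irreducibles_real(3)[OF r0] by (simp add: c_def)
    qed
    then have "2 * q ^ (g + 1) * \<bar>c - q ^ r / r\<bar> \<le> 2 * q ^ (g + 1) * (2 * sqrt q ^ g)"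
      using q1 by (intro mult_left_mono) auto
    moreover have "\<bar>c * (2 * q ^ (g + 1)) - 2 * q ^ (g + 1) * (q ^ r / r)\<bar> = 2 * q ^ (g + 1) * \<bar>c - q ^ r / r\<bar>"
    proof -
      have "c * (2 * q ^ (g + 1)) - 2 * q ^ (g + 1) * (q ^ r / r) = 2 * q ^ (g + 1) * (c - q ^ r / r)"
        by (simp add: algebra_simps)
      then show ?thesis using q1 by (simp add: abs_mult)
    qed
    ultimately show ?thesis using 1 by linarith
  qed
  then have "\<bar>\<Sum>r=1..g. (\<Sum>P\<in>?M r. ?T r P) - 2 * q ^ (g + 1) * (q ^ r / r)\<bar>
      \<le> (\<Sum>r=1..g. 12 * q ^ (g + 2) * (real g + 1) + 4 * q ^ (g + 1) * sqrt q ^ g)"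
    by (intro order_trans[OF sum_abs] sum_mono)
  also have "\<dots> = g * (12 * q ^ (g + 2) * (real g + 1)) + 4 * q ^ (g + 1) * g * sqrt q ^ g"
    by (simp only: sum_constant card_atLeastAtMost diff_Suc_1 distrib_left mult_ac)
  also have "g * (12 * q ^ (g + 2) * (real g + 1)) \<le> (real g + 1) * (12 * q ^ (g + 2) * (real g + 1))"
    using q1 by (intro mult_right_mono) auto
  finally show ?thesis
    by (simp add: sum_subtractf sum_distrib_left power2_eq_square mult_ac)
qed

text \<open>Character sums and prime counts cost about q^g g^2 and q^(3g/2) g, exponentially less
  than allowed. The order q^(2g)/g^2 comes from \<open>sum_powers_over_index\<close>, whose main
  term brings back Z = q/(q-1).\<close>

lemma sum_L_fun_H_set_asymp:
  "(\<lambda>g. (\<Sum>u\<in>H_set \<xi> (g + 1). L_fun 1 u) - complex_of_real (2 * Z * (q ^ (2 * g + 1) / g)))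
   \<in> O(\<lambda>g. complex_of_real (q ^ (2 * g) / (real g)\<^sup>2))"
proof -
  have q1: "q \<ge> 1" "q > 1" using q_ge_2 by auto
  obtain C where C: "\<And>g. g \<ge> 1 \<Longrightarrow> \<bar>(\<Sum>r=1..g. q ^ r / r) - q ^ (g + 1) / ((q - 1) * g)\<bar> \<le> C * (q ^ g / (real g)\<^sup>2)"
    using sum_powers_over_index[OF q_ge_2] by blast
  define T where "T g = (\<Sum>r=1..g. \<Sum>P\<in>(monic_irreducibles r :: 'a poly set). \<Sum>F\<in>G_set \<xi> (g + 1 - r).
       \<Sum>a\<in>polys_below (degree P) - {0}. L_val P a F (2 * degree P + 2 * (g + 1 - r) - 1))" for g
  \<comment> \<open>One comparison serves both small errors: the fourth power dominates the factors
    (g+1)^2 g^2 in \<open>e1\<close> and g^3 in \<open>e2\<close>, and sqrt 2 <= sqrt q.\<close>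
  have "((\<lambda>g::nat. (real g + 1) ^ 4 / sqrt 2 ^ g) \<longlongrightarrow> 0) at_top" by real_asymp
  then have "\<forall>\<^sub>F g::nat in at_top. (real g + 1) ^ 4 / sqrt 2 ^ g < 1" by (rule order_tendstoD) simp
  then have "\<forall>\<^sub>F g::nat in at_top. \<bar>T g - 2 * Z * (q ^ (2 * g + 1) / g)\<bar>
      \<le> (12 * q\<^sup>2 + 4 * q + 2 * q * C) * (q ^ (2 * g) / (real g)\<^sup>2)"
    using eventually_ge_at_top[of 1]
  proof eventually_elim
    case (elim g)
    define x where "x = real g"
    have x: "x \<ge> 1" using elim by (simp add: x_def)
    have "(x + 1) ^ 4 \<le> sqrt 2 ^ g" using elim by (simp add: x_def divide_simps split: if_splits)
    also have "\<dots> \<le> sqrt q ^ g" using q_ge_2 by (intro power_mono) auto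
    finally have x4: "(x + 1) ^ 4 \<le> sqrt q ^ g" .
    have main: "2 * q ^ (g + 1) * (q ^ (g + 1) / ((q - 1) * x)) = 2 * Z * (q ^ (2 * g + 1) / x)"
    proof -
      have Z: "Z = q / (q - 1)" using q1 by (simp add: Z_def field_simps)
      have pow: "q ^ (g + 1) * q ^ (g + 1) = q * q ^ (2 * g + 1)" by (simp add: mult_2 power_add)
      have "2 * q ^ (g + 1) * (q ^ (g + 1) / ((q - 1) * x)) = 2 * (q ^ (g + 1) * q ^ (g + 1)) / ((q - 1) * x)"
        by (simp only: times_divide_eq_right mult.assoc)
      also have "\<dots> = 2 * (q / (q - 1)) * (q ^ (2 * g + 1) / x)"
        unfolding pow by (simp only: times_divide_eq_right times_divide_eq_left divide_divide_eq_left mult_ac)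
      finally show ?thesis by (simp only: Z)
    qed
    have e1: "12 * q ^ (g + 2) * (x + 1)\<^sup>2 \<le> 12 * q\<^sup>2 * (q ^ (2 * g) / x\<^sup>2)"
    proof -
      have "(x + 1)\<^sup>2 * x\<^sup>2 \<le> (x + 1)\<^sup>2 * (x + 1)\<^sup>2" using x by (intro mult_left_mono power_mono) auto
      also have "\<dots> = (x + 1) ^ 4" by (simp flip: power_add)
      also have "\<dots> \<le> q ^ g"
        using x4 power_increasing[of g "2 * g" "sqrt q"] sqrt_q by (simp add: order_trans)
      finally have "q ^ g * ((x + 1)\<^sup>2 * x\<^sup>2) \<le> q ^ g * q ^ g" using q1 by (intro mult_left_mono) auto
      also have "\<dots> = q ^ (2 * g)" by (simp add: mult_2 power_add)
      finally have "q ^ g * (x + 1)\<^sup>2 \<le> q ^ (2 * g) / x\<^sup>2"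
        using x by (simp add: pos_le_divide_eq mult_ac)
      then have "12 * q\<^sup>2 * (q ^ g * (x + 1)\<^sup>2) \<le> 12 * q\<^sup>2 * (q ^ (2 * g) / x\<^sup>2)"
        by (intro mult_left_mono) auto
      then show ?thesis by (simp only: power_add mult_ac)
    qed
    have e2: "4 * q ^ (g + 1) * x * sqrt q ^ g \<le> 4 * q * (q ^ (2 * g) / x\<^sup>2)"
    proof -
      have "x * x\<^sup>2 \<le> (x + 1) ^ 3" using x power_mono[of x "x + 1" 3] by (simp add: power2_eq_square power3_eq_cube)
      also have "\<dots> \<le> (x + 1) ^ 4" using x by (intro power_increasing) auto
      also note x4
      finally have "q ^ g * sqrt q ^ g * (x * x\<^sup>2) \<le> q ^ g * sqrt q ^ g * sqrt q ^ g"
        using q1 by (intro mult_left_mono) auto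
      also have "\<dots> = q ^ (2 * g)" using sqrt_q(1)[of g] by (simp add: mult_2 power_add)
      finally have "q ^ g * sqrt q ^ g * x \<le> q ^ (2 * g) / x\<^sup>2"
        using x by (simp add: pos_le_divide_eq mult_ac)
      then have "4 * q * (q ^ g * sqrt q ^ g * x) \<le> 4 * q * (q ^ (2 * g) / x\<^sup>2)"
        using q1 by (intro mult_left_mono) auto
      then show ?thesis by (simp add: mult_ac)
    qed
    have "\<bar>2 * q ^ (g + 1) * (\<Sum>r=1..g. q ^ r / r) - 2 * q ^ (g + 1) * (q ^ (g + 1) / ((q - 1) * x))\<bar>
        = 2 * q ^ (g + 1) * \<bar>(\<Sum>r=1..g. q ^ r / r) - q ^ (g + 1) / ((q - 1) * x)\<bar>"
      unfolding right_diff_distrib[symmetric] abs_mult using q1 by simp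
    also have "\<dots> \<le> 2 * q ^ (g + 1) * (C * (q ^ g / x\<^sup>2))"
      using C[of g] elim q1 unfolding x_def by (intro mult_left_mono) auto
    also have "\<dots> = 2 * q * C * (q ^ (2 * g) / x\<^sup>2)"
    proof -
      have "q ^ (2 * g) = q ^ g * q ^ g" by (simp add: mult_2 power_add)
      then show ?thesis by (simp only: power_add power_one_right times_divide_eq_right mult_ac)
    qed
    finally have e3: "\<bar>2 * q ^ (g + 1) * (\<Sum>r=1..g. q ^ r / r) - 2 * q ^ (g + 1) * (q ^ (g + 1) / ((q - 1) * x))\<bar>
        \<le> 2 * q * C * (q ^ (2 * g) / x\<^sup>2)" .
    have e0: "\<bar>T g - 2 * q ^ (g + 1) * (\<Sum>r=1..g. q ^ r / r)\<bar>
        \<le> 12 * q ^ (g + 2) * (x + 1)\<^sup>2 + 4 * q ^ (g + 1) * x * sqrt q ^ g"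
      unfolding T_def x_def by (rule sum_L_val_H_bound)
    have tri: "\<bar>t - v\<bar> \<le> a + b + c" if "\<bar>t - u\<bar> \<le> a' + b'" "a' \<le> a" "b' \<le> b" "\<bar>u - v\<bar> \<le> c"
      for t u v a b c a' b' :: real
      using that by linarith
    have "\<bar>T g - 2 * q ^ (g + 1) * (q ^ (g + 1) / ((q - 1) * x))\<bar>
        \<le> 12 * q\<^sup>2 * (q ^ (2 * g) / x\<^sup>2) + 4 * q * (q ^ (2 * g) / x\<^sup>2) + 2 * q * C * (q ^ (2 * g) / x\<^sup>2)"
      by (rule tri[OF e0 e1 e2 e3])
    then show ?case unfolding main unfolding x_def by (simp only: distrib_right)
  qed
  then show ?thesis
    unfolding sum_L_fun_H_set T_def[symmetric]
  proof (intro bigoI[where c = "12 * q\<^sup>2 + 4 * q + 2 * q * C"], elim eventually_mono)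
    fix g
    have "0 \<le> q ^ (2 * g) / (real g)\<^sup>2" using q1 by simp
    moreover assume "\<bar>T g - 2 * Z * (q ^ (2 * g + 1) / g)\<bar>
      \<le> (12 * q\<^sup>2 + 4 * q + 2 * q * C) * (q ^ (2 * g) / (real g)\<^sup>2)"
    ultimately show "norm (complex_of_real (T g) - complex_of_real (2 * Z * (q ^ (2 * g + 1) / g)))
        \<le> (12 * q\<^sup>2 + 4 * q + 2 * q * C) * norm (complex_of_real (q ^ (2 * g) / (real g)\<^sup>2))"
      by (simp only: of_real_diff[symmetric] norm_of_real abs_of_nonneg)
  qed
qed

end

lemma zeta_A_2:
  assumes "q \<noteq> 0" shows "zeta_A q 2 = complex_of_real (1 / (1 - 1 / real q))"
  by (simp add: zeta_A_def powr_minus divide_inverse)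

theorem theorem2p19:
  fixes q :: nat and \<xi> :: "'a::finite_field"
  assumes "q = CARD('a)" and "\<exists>m. q = 2 ^ m" and "\<xi> \<notin> range wp"
  shows
    "(\<lambda>g. (\<Sum>u\<in>H_set \<xi> (g + 1). L_fun 1 u)
          - 2 * zeta_A q 2 * (of_nat q ^ (2 * g + 1) / of_nat g))
       \<in> O(\<lambda>g. of_nat q ^ (2 * g) / of_nat g ^ 2)
     \<and>
     (\<lambda>g. let absP = real q ^ (g + 1) in
          (\<Sum>P\<in>(monic_irreducibles (g + 1) :: 'a poly set). \<Sum>u\<in>F_at P. L_fun 1 u)
          - zeta_A q 2 * complex_of_real (absP ^ 2 / log (real q) absP))
       \<in> O(\<lambda>g. complex_of_real ((real q ^ (g + 1)) powr (3 / 2)))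
     \<and>
     (\<lambda>g. let absP = real q ^ (g + 1) in
          (\<Sum>P\<in>(monic_irreducibles (g + 1) :: 'a poly set). \<Sum>u\<in>F'_at \<xi> P. L_fun 1 u)
          - zeta_A q 2 * complex_of_real (absP ^ 2 / log (real q) absP))
       \<in> O(\<lambda>g. complex_of_real ((real q ^ (g + 1)) powr (3 / 2)))"
proof -
  interpret even_field \<xi> "real q"
    using assms by unfold_locales auto
  have q2: "real q \<ge> 2" by (rule q_ge_2)
  have zeta: "zeta_A q 2 = complex_of_real Z" using q2 by (subst zeta_A_2) (auto simp: Z_def)
  \<comment> \<open>Thus (2) and (3) are two instances of one estimate.\<close>
  have F_at: "F_at P = F'_at 0 P" for P :: "'a poly" by (auto simp: F'_at_def)
  have log: "log (real q) (real q ^ (g + 1)) = real (g + 1)" for g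
    using q2 by (subst log_nat_power) auto
  have powr: "(real q ^ (g + 1)) powr (3 / 2) = sqrt (real q) ^ (3 * (g + 1))" for g
  proof -
    have "(real q ^ (g + 1)) powr (3 / 2) = (sqrt (real q) powr real (2 * (g + 1))) powr (3 / 2)"
      using q2 unfolding sqrt_q(1)[symmetric] by (subst powr_realpow) auto
    moreover have "real (2 * (g + 1)) * (3 / 2) = real (3 * (g + 1))" by (simp add: field_simps)
    then have "(sqrt (real q) powr real (2 * (g + 1))) powr (3 / 2) = sqrt (real q) powr real (3 * (g + 1))"
      by (simp only: powr_powr)
    moreover have "sqrt (real q) powr real (3 * (g + 1)) = sqrt (real q) ^ (3 * (g + 1))" using q2 by (subst powr_realpow) auto
    ultimately show ?thesis by (simp only:)
  qed
  have "(\<lambda>g. let absP = real q ^ (g + 1) in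
          (\<Sum>P\<in>(monic_irreducibles (g + 1) :: 'a poly set). \<Sum>u\<in>F'_at \<alpha> P. L_fun 1 u)
          - zeta_A q 2 * complex_of_real (absP ^ 2 / log (real q) absP))
       \<in> O(\<lambda>g. complex_of_real ((real q ^ (g + 1)) powr (3 / 2)))" for \<alpha> :: 'a
  proof (intro bigoI[where c = 10] always_eventually allI)
    fix g
    have "(real q ^ (g + 1))\<^sup>2 = real q ^ (2 * (g + 1))" by (metis power_mult mult.commute)
    then have "zeta_A q 2 * complex_of_real ((real q ^ (g + 1))\<^sup>2 / log (real q) (real q ^ (g + 1)))
        = complex_of_real (Z * (real q ^ (2 * (g + 1)) / real (g + 1)))"
      by (simp only: zeta log of_real_mult)
    then show "norm (let absP = real q ^ (g + 1) in
          (\<Sum>P\<in>(monic_irreducibles (g + 1) :: 'a poly set). \<Sum>u\<in>F'_at \<alpha> P. L_fun 1 u)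
          - zeta_A q 2 * complex_of_real (absP ^ 2 / log (real q) absP))
        \<le> 10 * norm (complex_of_real ((real q ^ (g + 1)) powr (3 / 2)))"
      using sum_L_fun_F'_at_asymp[of "g + 1" \<alpha>] unfolding Let_def powr norm_of_real by simp
  qed
  from this[of 0] this[of \<xi>] sum_L_fun_H_set_asymp show ?thesis
    unfolding F_at zeta by simp
qed

end
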